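(* Let $0<\delta<1/2$ and let $\mathbf{p}=(p_k)_{k=0}^\infty$ be a sequence of positive integers with $p_0=1$, $p_k\mid p_{k+1}$ and $p_{k+1}/p_k\ge 3$ for all $k\ge 0$, satisfying $$\sum_{k=1}^\infty\frac{2p_k}{p_{k+1}}<\delta.$$ Then the minimal shift space $X(\mathbf{p})\subseteq\{0,1\}^\infty$, obtained as the orbit closure of the Oxtoby sequence $x(\mathbf{p})$ with scale $\mathbf{p}$, satisfies $$\bar d^H(X(\mathbf{p}),\{0^\infty,1^\infty\})>1-\delta\qquad\text{and}\qquad \bar d^H_{\mathcal M}(\mathcal{M}_\sigma(X(\mathbf{p})),\mathcal{M}_\sigma(\{0^\infty,1^\infty\}))<\delta.$$
   Context: Oxtoby sequence with scale $\mathbf{p}$: let $\mathbb{N}_0=\{0,1,2,\dots\}$, $M_0=\emptyset$ and, for $k\ge1$, $M_k=([-p_k,p_k)+p_{k+1}\mathbb{N}_0)\cap\mathbb{N}_0$. For each $i\in\mathbb{N}_0$ there is a unique $k=k(i)\ge 1$ with $i\in M_k\setminus\bigcup_{\ell=0}^{k-1}M_\ell$. The Oxtoby sequence is $x(\mathbf{p})\in\{0,1\}^\infty$ with $x(\mathbf{p})_i=k(i)\bmod 2$. $\{0,1\}^\infty$ is the set of sequences $(x_i)_{i\ge 0}$ with the product topology, $\sigma(x)_j=x_{j+1}$; $X(\mathbf{p})$ is the closure of $\{\sigma^n(x(\mathbf{p})): n\ge 0\}$. $0^\infty$ and $1^\infty$ are the constant sequences. For a shift space $X$ (nonempty closed with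 $\sigma(X)\subseteq X$), $\mathcal{M}_\sigma(X)$ is the set of $\sigma$-invariant Borel probability measures concentrated on $X$. $\bar d(x,y)=\limsup_{n\to\infty}\frac1n|\{0\le j<n: x_j\ne y_j\}|$. For $\sigma$-invariant measures $\mu,\nu$, $\bar d_{\mathcal M}(\mu,\nu)=\inf_\xi\xi(\{(x,y):x_0\ne y_0\})$, the infimum over all $\sigma\times\sigma$-invariant Borel probability measures $\xi$ with marginals $\mu,\nu$. For a bounded pseudometric $\rho$, $\rho^H(A,B)=\max\{\sup_{a\in A}\inf_{b\in B}\rho(a,b),\sup_{b\in B}\inf_{a\in A}\rho(a,b)\}$; $\bar d^H$ and $\bar d^H_{\mathcal M}$ are those induced by $\bar d$ and $\bar d_{\mathcal M}$. *)

theory Defs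
  imports "HOL-Probability.Probability"
begin

text \<open>
  The space of one-sided 0-1 sequences is the type \<^typ>\<open>nat \<Rightarrow> bool\<close>, with
  \<^const>\<open>False\<close> for 0 and \<^const>\<open>True\<close> for 1.  Its library topology is the product of the
  discrete topology on \<^typ>\<open>bool\<close>, and \<^term>\<open>borel\<close> is the corresponding Borel sigma-algebra.
\<close>

instance bool :: second_countable_topology
proof
  show "\<exists>B::bool set set. countable B \<and> open = generate_topology B"
    unfolding open_bool_def by (intro exI conjI) (auto intro: countable_finite)
qed

definition shift :: "(nat \<Rightarrow> bool) \<Rightarrow> (nat \<Rightarrow> bool)" where
  "shift x = (\<lambda>j. x (Suc j))"

definition orbit_closure :: "(nat \<Rightarrow> bool) \<Rightarrow> (nat \<Rightarrow> bool) set" where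
  "orbit_closure x = closure (range (\<lambda>n. (shift ^^ n) x))"

definition shift_space :: "(nat \<Rightarrow> bool) set \<Rightarrow> bool" where
  "shift_space X \<longleftrightarrow> X \<noteq> {} \<and> closed X \<and> shift ` X \<subseteq> X"

definition minimal_shift_space :: "(nat \<Rightarrow> bool) set \<Rightarrow> bool" where
  "minimal_shift_space X \<longleftrightarrow> shift_space X \<and> (\<forall>Y. shift_space Y \<and> Y \<subseteq> X \<longrightarrow> Y = X)"

definition oxtoby_M :: "(nat \<Rightarrow> nat) \<Rightarrow> nat \<Rightarrow> nat set" where
  "oxtoby_M p k =
     (if k = 0 then {}
      else {i. \<exists>a\<in>{- int (p k)..<int (p k)}. \<exists>m::nat. int i = a + int (p (Suc k)) * int m})"

definition oxtoby_index :: "(nat \<Rightarrow> nat) \<Rightarrow> nat \<Rightarrow> nat" where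
  "oxtoby_index p i = (THE k. k \<ge> 1 \<and> i \<in> oxtoby_M p k - (\<Union>l<k. oxtoby_M p l))"

definition oxtoby :: "(nat \<Rightarrow> nat) \<Rightarrow> (nat \<Rightarrow> bool)" where
  "oxtoby p = (\<lambda>i. oxtoby_index p i mod 2 = 1)"

definition invariant_measures :: "(nat \<Rightarrow> bool) set \<Rightarrow> (nat \<Rightarrow> bool) measure set" where
  "invariant_measures X =
     {\<mu>. sets \<mu> = sets borel \<and> prob_space \<mu> \<and> distr \<mu> borel shift = \<mu> \<and> emeasure \<mu> X = 1}"

definition joinings ::
    "(nat \<Rightarrow> bool) measure \<Rightarrow> (nat \<Rightarrow> bool) measure \<Rightarrow> ((nat \<Rightarrow> bool) \<times> (nat \<Rightarrow> bool)) measure set" where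
  "joinings \<mu> \<nu> =
     {\<xi>. sets \<xi> = sets borel \<and> prob_space \<xi> \<and> distr \<xi> borel (map_prod shift shift) = \<xi> \<and>
         distr \<xi> borel fst = \<mu> \<and> distr \<xi> borel snd = \<nu>}"

text \<open>
  The pseudometrics are valued in the complete lattice \<^typ>\<open>ereal\<close>, so that every limsup, supremum
  and infimum below exists unconditionally; in particular an infimum over the empty set is infinite.
  The quotient for \<open>n = 0\<close> is 0 and does not influence the limsup.
\<close>

definition dbar :: "(nat \<Rightarrow> bool) \<Rightarrow> (nat \<Rightarrow> bool) \<Rightarrow> ereal" where
  "dbar x y = limsup (\<lambda>n. ereal (real (card {j. j < n \<and> x j \<noteq> y j}) / real n))"

definition dbar_measure :: "(nat \<Rightarrow> bool) measure \<Rightarrow> (nat \<Rightarrow> bool) measure \<Rightarrow> ereal" where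
  "dbar_measure \<mu> \<nu> = (INF \<xi>\<in>joinings \<mu> \<nu>. ereal (measure \<xi> {(x, y). x 0 \<noteq> y 0}))"

definition hausdorff :: "('a \<Rightarrow> 'a \<Rightarrow> ereal) \<Rightarrow> 'a set \<Rightarrow> 'a set \<Rightarrow> ereal" where
  "hausdorff \<rho> A B = max (SUP a\<in>A. INF b\<in>B. \<rho> a b) (SUP b\<in>B. INF a\<in>A. \<rho> a b)"

end

theory Submission
  imports Defs
begin

text \<open>
  Write \<open>S\<close> for the sum of the numbers \<open>2 p\<^sub>k / p\<^sub>k\<^sub>+\<^sub>1\<close>, \<open>k \<ge> 1\<close>. Everything rests on the hierarchical
  structure of the Oxtoby sequence \<open>x\<close>. Call a position a hole of level \<open>K\<close> if it lies in none of
  \<open>M\<^sub>1, \<dots>, M\<^sub>K\<close>. Outside the holes of level \<open>K\<close> the sequence is periodic with period \<open>p\<^sub>K\<^sub>+\<^sub>1\<close>; the holes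
  themselves form a periodic set of density at least \<open>1 - S\<close>; and inside a block
  \<open>[m p\<^sub>K\<^sub>+\<^sub>1, (m + 1) p\<^sub>K\<^sub>+\<^sub>1)\<close> all holes carry the same symbol (\<open>oxtoby_cong_mod\<close>,
  \<open>card_window_hole_ge\<close>, \<open>oxtoby_cong_div\<close>).

  Minimality holds because every prefix of \<open>x\<close> recurs periodically. In the first block of level
  \<open>K\<close> the symbol filling the holes is determined by the parity of \<open>K\<close>. So along \<open>K\<close> of either parity
  the prefixes of \<open>x\<close> consist of one symbol up to density \<open>S\<close>, whence \<open>x\<close> has distance at least
  \<open>1 - S\<close> to both constant sequences (\<open>dbar_oxtoby_const_ge\<close>).

  Every invariant measure is nevertheless close to an invariant measure on the two constant
  sequences. For \<open>\<mu>\<close> on the orbit closure, look at the majority symbol in the window of length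
  \<open>p\<^sub>K\<^sub>+\<^sub>1\<close> starting at the origin. It is the symbol in the holes of that window unless the window
  meets \<open>M\<^sub>K\<^sub>+\<^sub>1\<close>, which has probability of order \<open>p\<^sub>K\<^sub>+\<^sub>1 / p\<^sub>K\<^sub>+\<^sub>2\<close>. These numbers are summable, so by
  Borel and Cantelli the majority symbol stabilises almost surely as \<open>K\<close> grows, to a symbol that
  is invariant under the shift. The map sending a point to the constant sequence of its
  limiting symbol is therefore a factor map modulo null sets, and its graph is a joining of
  cost at most \<open>S\<close> (\<open>ex_constant_measure_near\<close>).

  Conversely, an invariant measure on the constant sequences is a mixture of two point
  masses, so it is enough to find, for each symbol, an invariant measure on the orbit closure
  giving the other symbol probability at most \<open>S\<close>. Such measures are limits of the uniform
  measures on \<open>x, \<sigma> x, \<dots>, \<sigma>\<^sup>n x\<close> with \<open>n + 1 = p\<^sub>K\<close> and \<open>K\<close> of fixed parity. The limit exists in a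
  strong form: the random starting points can be coupled through a uniform real so that
  consecutive ones agree modulo \<open>p\<^sub>K\<close>; then the shifted sequences converge almost surely, again
  by Borel and Cantelli (\<open>AE_sample_converges\<close>, \<open>ex_measure_near_constant\<close>).
\<close>

section \<open>The space of binary sequences\<close>

lemma funpow_shift: "(shift ^^ n) y = (\<lambda>i. y (n + i))"
  by (induction n arbitrary: y) (simp_all add: shift_def funpow_Suc_right del: funpow.simps)

lemma open_cylinder: "open {z :: nat \<Rightarrow> bool. \<forall>i<n. z i = y i}"
proof -
  have "{z :: nat \<Rightarrow> bool. \<forall>i<n. z i = y i} = (\<Inter>i\<in>{..<n}. (\<lambda>z. z i) -` {y i})"
    by auto
  moreover have "open {b}" for b :: bool
  proof -
    have "{b} = (if b then {False<..} else {..<True})"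
      by (auto simp: less_bool_def)
    then show ?thesis by simp
  qed
  then have "open ((\<lambda>z :: nat \<Rightarrow> bool. z i) -` {y i})" for i
    by (intro open_vimage continuous_on_product_coordinates)
  ultimately show ?thesis
    by auto
qed

lemma open_iff_cylinder:
  fixes S :: "(nat \<Rightarrow> bool) set"
  shows "open S \<longleftrightarrow> (\<forall>y\<in>S. \<exists>n. {z. \<forall>i<n. z i = y i} \<subseteq> S)"
proof
  assume "open S"
  show "\<forall>y\<in>S. \<exists>n. {z. \<forall>i<n. z i = y i} \<subseteq> S"
  proof
    fix y assume "y \<in> S"
    have "openin (product_topology (\<lambda>_. euclidean) UNIV) S"
      using \<open>open S\<close> by (simp add: open_fun_def)
    from product_topology_open_contains_basis[OF this \<open>y \<in> S\<close>]
    obtain X where X: "y \<in> Pi\<^sub>E UNIV X" "finite {i. X i \<noteq> UNIV}" "Pi\<^sub>E UNIV X \<subseteq> S"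
      by (metis topspace_euclidean)
    obtain n where n: "\<And>i. X i \<noteq> UNIV \<Longrightarrow> i < n"
      using finite_nat_bounded[OF X(2)] by (auto simp: subset_iff)
    have "z \<in> Pi\<^sub>E UNIV X" if z: "\<forall>i<n. z i = y i" for z
    proof (rule PiE_I)
      fix i
      show "z i \<in> X i"
      proof (cases "X i = UNIV")
        case False
        then show ?thesis using n z PiE_mem[OF X(1)] by auto
      qed simp
    qed simp
    from subsetD[OF X(3) this] have "{z. \<forall>i<n. z i = y i} \<subseteq> S"
      by (intro subsetI) simp
    then show "\<exists>n. {z. \<forall>i<n. z i = y i} \<subseteq> S" ..
  qed
next
  assume *: "\<forall>y\<in>S. \<exists>n. {z. \<forall>i<n. z i = y i} \<subseteq> S"
  show "open S"
  proof (subst open_subopen, intro ballI)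
    fix y assume "y \<in> S"
    then obtain n where "{z. \<forall>i<n. z i = y i} \<subseteq> S" using * by blast
    then show "\<exists>T. open T \<and> y \<in> T \<and> T \<subseteq> S"
      by (intro exI[of _ "{z. \<forall>i<n. z i = y i}"]) (simp add: open_cylinder)
  qed
qed

lemma closure_iff_cylinder:
  fixes S :: "(nat \<Rightarrow> bool) set"
  shows "y \<in> closure S \<longleftrightarrow> (\<forall>n. \<exists>z\<in>S. \<forall>i<n. z i = y i)"
proof
  assume y: "y \<in> closure S"
  show "\<forall>n. \<exists>z\<in>S. \<forall>i<n. z i = y i"
  proof
    fix n
    show "\<exists>z\<in>S. \<forall>i<n. z i = y i"
      using y[unfolded closure_iff_nhds_not_empty, rule_format, OF order_refl open_cylinder[of n y]]
      by auto
  qed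
next
  assume *: "\<forall>n. \<exists>z\<in>S. \<forall>i<n. z i = y i"
  have "S \<inter> A \<noteq> {}" if V: "V \<subseteq> A" "y \<in> V" "open V" for A V
  proof -
    obtain n where "{z. \<forall>i<n. z i = y i} \<subseteq> V"
      using V open_iff_cylinder by blast
    moreover obtain z where "z \<in> S" "\<forall>i<n. z i = y i"
      using * by auto
    ultimately have "z \<in> S \<inter> A" using V(1) by auto
    then show ?thesis by auto
  qed
  then show "y \<in> closure S"
    unfolding closure_iff_nhds_not_empty by blast
qed

lemma continuous_on_shift: "continuous_on UNIV shift"
  unfolding shift_def by (intro continuous_on_coordinatewise_then_product) simp

lemma shift_measurable [measurable]: "shift \<in> borel_measurable borel"
  using continuous_on_shift by (rule borel_measurable_continuous_onI)

definition depends_on :: "nat \<Rightarrow> (nat \<Rightarrow> bool) set \<Rightarrow> bool" where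
  "depends_on W C \<longleftrightarrow> (\<forall>y z. (\<forall>i<W. y i = z i) \<longrightarrow> (y \<in> C \<longleftrightarrow> z \<in> C))"

text \<open>
  Finitary sets are exactly the clopen sets. They are what window counts along an orbit can
  see, and they generate the Borel sigma-algebra.
\<close>

definition finitary :: "(nat \<Rightarrow> bool) set \<Rightarrow> bool" where
  "finitary C \<longleftrightarrow> (\<exists>W. depends_on W C)"

lemma depends_onD:
  assumes "depends_on W C" "\<And>i. i < W \<Longrightarrow> y i = z i"
  shows "y \<in> C \<longleftrightarrow> z \<in> C"
  using assms(1)[unfolded depends_on_def, THEN spec, THEN spec, of y z] assms(2) by simp

lemma finitaryI:
  assumes "\<And>y z. (\<And>i. i < W \<Longrightarrow> y i = z i) \<Longrightarrow> y \<in> C \<longleftrightarrow> z \<in> C"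
  shows "finitary C"
  unfolding finitary_def depends_on_def
proof (intro exI[of _ W] allI impI)
  fix y z :: "nat \<Rightarrow> bool" assume "\<forall>i<W. y i = z i"
  then show "y \<in> C \<longleftrightarrow> z \<in> C" by (intro assms) simp
qed

lemma finitary_open:
  assumes "finitary C"
  shows "open C"
  unfolding open_iff_cylinder
proof
  obtain W where W: "depends_on W C"
    using assms unfolding finitary_def by (elim exE)
  fix y assume "y \<in> C"
  then have "z \<in> C" if "\<forall>i<W. z i = y i" for z
    using depends_onD[OF W, of z y] that by simp
  then have "{z. \<forall>i<W. z i = y i} \<subseteq> C" by (intro subsetI) simp
  then show "\<exists>n. {z. \<forall>i<n. z i = y i} \<subseteq> C" ..
qed

lemma finitary_borel [measurable_dest]: "finitary C \<Longrightarrow> C \<in> sets borel"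
  by (simp add: finitary_open)

text \<open>
  The finitary sets contain an intersection-stable generator of the Borel sets, so a finite
  measure is determined by its values on them.
\<close>

lemma finite_borel_measure_eqI:
  fixes M N :: "(nat \<Rightarrow> bool) measure"
  assumes "sets M = sets borel" "sets N = sets borel" "finite_measure M"
    and eq: "\<And>C. finitary C \<Longrightarrow> emeasure M C = emeasure N C"
  shows "M = N"
proof (rule measure_eqI_PiM_infinite[where I = UNIV and M = "\<lambda>_. borel"])
  show "sets M = sets (PiM UNIV (\<lambda>_. borel))" "sets N = sets (PiM UNIV (\<lambda>_. borel))"
    using assms by (simp_all add: sets_PiM_equal_borel)
  fix A :: "nat \<Rightarrow> bool set" and J :: "nat set"
  assume J: "finite J"
  then obtain W where W: "\<And>i. i \<in> J \<Longrightarrow> i < W"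
    using finite_nat_bounded[OF J] by (auto simp: subset_iff)
  have "prod_emb UNIV (\<lambda>_. borel :: bool measure) J (Pi\<^sub>E J A) = {y. \<forall>i\<in>J. y i \<in> A i}"
    by (auto simp: prod_emb_def PiE_iff space_PiM)
  moreover have "finitary {y. \<forall>i\<in>J. y i \<in> A i}"
    by (rule finitaryI[of W]) (simp add: W)
  ultimately show "emeasure M (prod_emb UNIV (\<lambda>_. borel) J (Pi\<^sub>E J A)) = emeasure N (prod_emb UNIV (\<lambda>_. borel) J (Pi\<^sub>E J A))"
    using eq by simp
qed fact

lemma finitary_coord: "finitary {y. y i}"
  by (rule finitaryI[of "Suc i"]) simp

lemma finitary_binop:
  assumes "finitary {y. P y}" "finitary {y. Q y}"
  shows "finitary {y. op (P y) (Q y)}"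
proof -
  obtain V where V: "depends_on V {y. P y}"
    using assms(1) unfolding finitary_def by (elim exE)
  obtain W where W: "depends_on W {y. Q y}"
    using assms(2) unfolding finitary_def by (elim exE)
  show ?thesis
  proof (rule finitaryI[of "max V W"])
    fix y z :: "nat \<Rightarrow> bool" assume eq: "\<And>i. i < max V W \<Longrightarrow> y i = z i"
    have "P y = P z" using depends_onD[OF V, of y z] eq by simp
    moreover have "Q y = Q z" using depends_onD[OF W, of y z] eq by simp
    ultimately show "y \<in> {y. op (P y) (Q y)} \<longleftrightarrow> z \<in> {y. op (P y) (Q y)}" by simp
  qed
qed

lemma finitary_shift:
  assumes "finitary C"
  shows "finitary {y. shift y \<in> C}"
proof -
  obtain W where W: "depends_on W C"
    using assms unfolding finitary_def by (elim exE)
  show ?thesis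
  proof (rule finitaryI[of "Suc W"])
    fix y z :: "nat \<Rightarrow> bool" assume "\<And>i. i < Suc W \<Longrightarrow> y i = z i"
    then show "y \<in> {y. shift y \<in> C} \<longleftrightarrow> z \<in> {y. shift y \<in> C}"
      using depends_onD[OF W, of "shift y" "shift z"] by (simp add: shift_def)
  qed
qed

text \<open>
  Agreement of a limit point with a constant sequence on the window up to \<open>i\<close> compares the
  coordinates \<open>0\<close> and \<open>i\<close>.
\<close>

lemma closed_constants: "closed {\<lambda>_ :: nat. False, \<lambda>_. True}" (is "closed ?C")
proof -
  have "y \<in> ?C" if y: "y \<in> closure ?C" for y
  proof -
    have "y i = y 0" for i
    proof -
      obtain z where "z \<in> ?C" "\<forall>j<Suc i. z j = y j"
        using y[unfolded closure_iff_cylinder, THEN spec, of "Suc i"] by (elim bexE)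
      moreover from this(2) have "z i = y i" "z 0 = y 0" by simp_all
      ultimately show ?thesis by auto
    qed
    then have "y = (\<lambda>_. y 0)" by (intro ext)
    then show ?thesis by (cases "y 0") simp_all
  qed
  then have "closure ?C = ?C" using closure_subset[of ?C] by (intro equalityI) (intro subsetI)
  then show ?thesis by (simp only: closure_eq)
qed

lemma pred_borel_measurable:
  fixes P :: "'a \<Rightarrow> bool"
  assumes "Measurable.pred M P"
  shows "P \<in> borel_measurable M"
  by (rule borel_measurableI) (rule measurable_sets[OF assms], simp)

lemma mem_orbit_closure_iff:
  "y \<in> orbit_closure x \<longleftrightarrow> (\<forall>W. \<exists>n. \<forall>i<W. y i = x (n + i))"
  unfolding orbit_closure_def closure_iff_cylinder by (simp add: funpow_shift eq_commute[of "y _"])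

section \<open>Stationary joint laws\<close>

text \<open>
  Dominated convergence for indicators: the form in which almost sure stabilisation of events
  is used.
\<close>

lemma (in prob_space) tendsto_prob_of_AE_eventually:
  assumes [measurable]: "\<And>n. A n \<in> events" "B \<in> events"
    and ae: "AE u in M. \<forall>\<^sub>F n in sequentially. u \<in> A n \<longleftrightarrow> u \<in> B"
  shows "(\<lambda>n. prob (A n)) \<longlonglongrightarrow> prob B"
proof -
  have "(\<lambda>n. \<integral>u. indicator (A n) u \<partial>M) \<longlonglongrightarrow> (\<integral>u. (indicator B u :: real) \<partial>M)"
  proof (rule integral_dominated_convergence[where w = "\<lambda>_. 1"])
    show "AE u in M. (\<lambda>n. indicator (A n) u) \<longlonglongrightarrow> (indicator B u :: real)"
      using ae
    proof eventually_elim
      case (elim u)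
      then have "\<forall>\<^sub>F n in sequentially. indicator (A n) u = (indicator B u :: real)"
        by eventually_elim (auto simp: indicator_def)
      then show ?case by (rule tendsto_eventually)
    qed
  qed (auto simp: indicator_def)
  then show ?thesis
    by simp
qed

text \<open>
  Equivariance is asked for off a null set only, because the factor maps built below are
  defined by almost sure limits.
\<close>

lemma distr_invariant:
  assumes [measurable]: "T \<in> measurable \<Omega> \<Omega>" "h \<in> measurable \<Omega> N" "\<phi> \<in> measurable N N"
    and T: "distr \<Omega> \<Omega> T = \<Omega>" and ae: "AE w in \<Omega>. h (T w) = \<phi> (h w)"
  shows "distr (distr \<Omega> N h) N \<phi> = distr \<Omega> N h"
proof -
  have "distr (distr \<Omega> N h) N \<phi> = distr \<Omega> N (\<lambda>w. \<phi> (h w))"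
    by (simp add: distr_distr comp_def)
  also have "\<dots> = distr \<Omega> N (\<lambda>w. h (T w))"
    using ae by (intro distr_cong_AE) auto
  also have "\<dots> = distr (distr \<Omega> \<Omega> T) N h"
    by (simp add: distr_distr comp_def)
  finally show ?thesis unfolding T .
qed

lemma distr_mem_invariant_measures:
  assumes "prob_space \<Omega>" and [measurable]: "T \<in> measurable \<Omega> \<Omega>" "f \<in> borel_measurable \<Omega>"
    and T: "distr \<Omega> \<Omega> T = \<Omega>" and ae: "AE w in \<Omega>. f (T w) = shift (f w)"
    and X: "closed X" "AE w in \<Omega>. f w \<in> X"
  shows "distr \<Omega> borel f \<in> invariant_measures X"
proof -
  interpret prob_space \<Omega> by fact
  have [measurable]: "X \<in> sets borel" using X(1) by simp
  interpret D: prob_space "distr \<Omega> borel f" by (rule prob_space_distr) measurable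
  have "AE y in distr \<Omega> borel f. y \<in> X"
    using X(2) by (subst AE_distr_iff) auto
  then have "emeasure (distr \<Omega> borel f) X = 1"
    by (subst D.emeasure_eq_1_AE) auto
  then show ?thesis
    unfolding invariant_measures_def
    using distr_invariant[OF assms(2,3) shift_measurable T ae] D.prob_space_axioms by simp
qed

text \<open>
  Joinings are produced as joint laws: two factor maps \<open>f\<close> and \<open>g\<close> of one measure-preserving
  system, equivariant only almost everywhere, have an invariant joint law, whose cost is the
  probability that \<open>f\<close> and \<open>g\<close> differ at the origin.
\<close>

lemma dbar_measure_distr_le:
  assumes "prob_space \<Omega>" and [measurable]: "T \<in> measurable \<Omega> \<Omega>"
    and [measurable]: "f \<in> borel_measurable \<Omega>" "g \<in> borel_measurable \<Omega>"
    and T: "distr \<Omega> \<Omega> T = \<Omega>"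
    and ae: "AE w in \<Omega>. f (T w) = shift (f w)" "AE w in \<Omega>. g (T w) = shift (g w)"
  shows "dbar_measure (distr \<Omega> borel f) (distr \<Omega> borel g)
    \<le> ereal (measure \<Omega> {w \<in> space \<Omega>. f w 0 \<noteq> g w 0})"
proof -
  interpret prob_space \<Omega> by fact
  define h where "h = (\<lambda>w. (f w, g w))"
  have h [measurable]: "h \<in> borel_measurable \<Omega>"
    unfolding h_def borel_prod[symmetric] by measurable
  have \<phi> [measurable]: "map_prod shift shift \<in> borel_measurable borel"
    unfolding borel_prod[symmetric] map_prod_def by measurable
  have fs [measurable]: "(fst :: (nat \<Rightarrow> bool) \<times> (nat \<Rightarrow> bool) \<Rightarrow> _) \<in> borel_measurable borel"
    "(snd :: (nat \<Rightarrow> bool) \<times> (nat \<Rightarrow> bool) \<Rightarrow> _) \<in> borel_measurable borel"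
    unfolding borel_prod[symmetric] by measurable
  have "AE w in \<Omega>. h (T w) = map_prod shift shift (h w)"
    using ae by eventually_elim (simp add: h_def)
  then have "distr \<Omega> borel h \<in> joinings (distr \<Omega> borel f) (distr \<Omega> borel g)"
    unfolding joinings_def
    using distr_invariant[OF _ h \<phi> T] prob_space_distr[OF h]
    by (simp add: distr_distr[OF fs(1) h] distr_distr[OF fs(2) h] comp_def) (simp add: h_def)
  moreover have "{(x, y). x 0 \<noteq> y 0} \<in> sets (borel :: ((nat \<Rightarrow> bool) \<times> (nat \<Rightarrow> bool)) measure)"
  proof -
    have [measurable]: "Measurable.pred borel (\<lambda>x :: nat \<Rightarrow> bool. x 0)"
      using finitary_borel[OF finitary_coord] by (simp add: pred_def)
    have "{z \<in> space borel. fst z 0 \<noteq> snd z 0} \<in> sets (borel :: ((nat \<Rightarrow> bool) \<times> (nat \<Rightarrow> bool)) measure)"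
      by measurable
    then show ?thesis by (simp add: case_prod_beta)
  qed
  then have "measure (distr \<Omega> borel h) {(x, y). x 0 \<noteq> y 0} = measure \<Omega> {w \<in> space \<Omega>. f w 0 \<noteq> g w 0}"
    by (subst measure_distr[OF h]) (auto simp: h_def intro!: arg_cong[where f = "measure \<Omega>"])
  ultimately show ?thesis
    unfolding dbar_measure_def by (metis (no_types, lifting) INF_lower)
qed

lemma distr_pair_invariant:
  assumes "prob_space A" "prob_space B"
    and [measurable]: "\<phi> \<in> A \<rightarrow>\<^sub>M A" "\<psi> \<in> B \<rightarrow>\<^sub>M B"
    and "distr A A \<phi> = A" "distr B B \<psi> = B"
  shows "distr (A \<Otimes>\<^sub>M B) (A \<Otimes>\<^sub>M B) (map_prod \<phi> \<psi>) = A \<Otimes>\<^sub>M B"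
proof -
  interpret B: prob_space B by fact
  have "distr A A \<phi> \<Otimes>\<^sub>M distr B B \<psi> = distr (A \<Otimes>\<^sub>M B) (A \<Otimes>\<^sub>M B) (\<lambda>(x, y). (\<phi> x, \<psi> y))"
    using assms(3,4) by (rule pair_measure_distr) (simp add: assms(6) B.sigma_finite_measure_axioms)
  then show ?thesis by (simp add: assms(5,6) map_prod_def)
qed

lemma measure_pair_Times:
  assumes "prob_space B" "E \<in> sets A" "F \<in> sets B"
  shows "measure (A \<Otimes>\<^sub>M B) (E \<times> F) = measure A E * measure B F"
proof -
  interpret B: prob_space B by fact
  show ?thesis
    using B.emeasure_pair_measure_Times[OF assms(2,3)] by (simp add: measure_def enn2real_mult)
qed

lemma distr_pair_snd:
  assumes "prob_space A" "prob_space B"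
  shows "distr (A \<Otimes>\<^sub>M B) B snd = B"
proof (rule measure_eqI)
  interpret A: prob_space A by fact
  interpret B: prob_space B by fact
  fix F assume F: "F \<in> sets (distr (A \<Otimes>\<^sub>M B) B snd)"
  then have "snd -` F \<inter> space (A \<Otimes>\<^sub>M B) = space A \<times> F"
    using sets.sets_into_space[of F B] by (auto simp: space_pair_measure)
  then show "emeasure (distr (A \<Otimes>\<^sub>M B) B snd) F = emeasure B F"
    using F by (simp add: emeasure_distr B.emeasure_pair_measure_Times A.emeasure_space_1)
qed simp

section \<open>The levels of the Oxtoby sequence\<close>

text \<open>
  Translation permutes the residues, so each period inside the window contributes the same
  number.
\<close>

lemma card_window_mod:
  fixes m N n :: nat
  assumes "m > 0" "m dvd N"
  shows "card {j. j < N \<and> (n + j) mod m \<in> B} = N div m * card (B \<inter> {..<m})"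
proof -
  have period: "card {j. j < m \<and> (a + j) mod m \<in> B} = card (B \<inter> {..<m})" for a
  proof (rule bij_betw_same_card[where f = "\<lambda>j. (a + j) mod m"])
    have inj: "inj_on (\<lambda>j. (a + j) mod m) {..<m}"
    proof (rule linorder_inj_onI')
      fix i j assume ij: "i \<in> {..<m}" "j \<in> {..<m}" "i < j"
      then have "\<not> m dvd (a + j) - (a + i)"
        by (auto dest: dvd_imp_le)
      then show "(a + i) mod m \<noteq> (a + j) mod m"
        using ij mod_eq_dvd_iff_nat[of "a + i" "a + j" m] by auto
    qed
    have surj: "(\<lambda>j. (a + j) mod m) ` {..<m} = {..<m}"
      using inj assms(1) by (intro endo_inj_surj) auto
    show "bij_betw (\<lambda>j. (a + j) mod m) {j. j < m \<and> (a + j) mod m \<in> B} (B \<inter> {..<m})"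
      unfolding bij_betw_def
    proof
      show "inj_on (\<lambda>j. (a + j) mod m) {j. j < m \<and> (a + j) mod m \<in> B}"
        using inj by (rule inj_on_subset) auto
      show "(\<lambda>j. (a + j) mod m) ` {j. j < m \<and> (a + j) mod m \<in> B} = B \<inter> {..<m}"
        using surj by auto
    qed
  qed
  have "card {j. j < m * t \<and> (n + j) mod m \<in> B} = t * card (B \<inter> {..<m})" for t
  proof (induction t)
    case (Suc t)
    have split: "{j. j < m * Suc t \<and> (n + j) mod m \<in> B} =
        {j. j < m * t \<and> (n + j) mod m \<in> B} \<union>
        (\<lambda>j. m * t + j) ` {j. j < m \<and> (n + m * t + j) mod m \<in> B}" (is "?L = ?A \<union> ?B")
    proof (intro equalityI subsetI)
      fix j assume j: "j \<in> ?L"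
      show "j \<in> ?A \<union> ?B"
      proof (cases "j < m * t")
        case False
        then have "j = m * t + (j - m * t)" by simp
        moreover have "j - m * t \<in> {j. j < m \<and> (n + m * t + j) mod m \<in> B}"
          using j False by auto
        ultimately show ?thesis by blast
      qed (use j in simp)
    qed (auto simp: add.assoc)
    have "card ?L = card (?A \<union> ?B)" unfolding split ..
    also have "\<dots> = card ?A + card ?B"
      by (intro card_Un_disjoint) auto
    also have "card ?B = card {j. j < m \<and> (n + m * t + j) mod m \<in> B}"
      by (rule card_image) (rule inj_onI, rule add_left_imp_eq)
    finally show ?case
      unfolding Suc.IH period by (simp only: mult_Suc add.commute)
  qed simp
  from this[of "N div m"] show ?thesis
    using assms by simp
qed

text \<open>
  Only the end points of the window matter, so limits of empirical frequencies along an orbit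
  are shift-invariant.
\<close>

lemma card_Suc_window_diff:
  "\<bar>real (card {z. z < N \<and> Q (Suc z)}) - real (card {z. z < N \<and> Q z})\<bar> \<le> 1"
proof -
  have img: "card (Suc ` {z. z < N \<and> Q (Suc z)}) = card {z. z < N \<and> Q (Suc z)}"
    by (rule card_image) simp
  have "Suc ` {z. z < N \<and> Q (Suc z)} \<subseteq> insert N {z. z < N \<and> Q z}" by auto
  then have "card {z. z < N \<and> Q (Suc z)} \<le> card (insert N {z. z < N \<and> Q z})"
    unfolding img[symmetric] by (intro card_mono) auto
  also have "\<dots> \<le> Suc (card {z. z < N \<and> Q z})" by (rule card_insert_le_m1) simp_all
  finally have 1: "card {z. z < N \<and> Q (Suc z)} \<le> Suc (card {z. z < N \<and> Q z})" .
  have "{z. z < N \<and> Q z} \<subseteq> insert 0 (Suc ` {z. z < N \<and> Q (Suc z)})"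
  proof
    fix z assume "z \<in> {z. z < N \<and> Q z}"
    then show "z \<in> insert 0 (Suc ` {z. z < N \<and> Q (Suc z)})" by (cases z) auto
  qed
  then have "card {z. z < N \<and> Q z} \<le> card (insert 0 (Suc ` {z. z < N \<and> Q (Suc z)}))"
    by (intro card_mono) auto
  also have "\<dots> \<le> Suc (card (Suc ` {z. z < N \<and> Q (Suc z)}))" by (rule card_insert_le_m1) simp_all
  finally have "card {z. z < N \<and> Q z} \<le> Suc (card {z. z < N \<and> Q (Suc z)})" unfolding img .
  with 1 show ?thesis by linarith
qed

text \<open>
  The growth factor keeps the two ends of a period that make up \<open>M\<^sub>k\<close> disjoint, and it makes the
  intervals \<open>[0, p\<^sub>k)\<close>, each inside \<open>M\<^sub>k\<close>, exhaust the natural numbers.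
\<close>

locale oxtoby_scale =
  fixes p :: "nat \<Rightarrow> nat"
  assumes p_pos: "\<And>k. p k > 0"
    and p_0: "p 0 = 1"
    and p_dvd_Suc: "\<And>k. p k dvd p (Suc k)"
    and p_ratio: "\<And>k. 3 * p k \<le> p (Suc k)"
begin

lemma p_dvd: "i \<le> j \<Longrightarrow> p i dvd p j"
  by (induction rule: dec_induct) (auto intro: dvd_trans p_dvd_Suc)

lemma power_le_p: "3 ^ n \<le> p n"
proof (induction n)
  case (Suc n)
  then show ?case using p_ratio[of n] by simp
qed (simp add: p_0)

lemma less_p: "n < p n"
proof -
  have "n < 3 ^ n" by (rule less_exp[THEN less_le_trans]) (simp add: power_mono)
  then show ?thesis using power_le_p[of n] by simp
qed

lemma strict_mono_p: "strict_mono p"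
  unfolding strict_mono_Suc_iff
proof
  fix k
  show "p k < p (Suc k)" using p_ratio[of k] p_pos[of k] by linarith
qed

text \<open>
  Periodicity of \<open>M\<^sub>k\<close>. The part \<open>[-p\<^sub>k, 0)\<close> of the translate with \<open>m = 0\<close> consists of negative
  integers and drops out; its later translates are the upper end of each period.
\<close>

lemma mem_M_iff:
  "n \<in> oxtoby_M p k \<longleftrightarrow>
    0 < k \<and> (n mod p (Suc k) < p k \<or> p (Suc k) - p k \<le> n mod p (Suc k))"
proof (cases "k = 0")
  case False
  define P q where "P = p (Suc k)" and "q = p k"
  have P: "q < P" "0 < P"
    using p_ratio[of k] p_pos[of k] by (auto simp: P_def q_def)
  have "(\<exists>a\<in>{- int q..<int q}. \<exists>m::nat. int n = a + int P * int m) \<longleftrightarrow>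
      n mod P < q \<or> P - q \<le> n mod P" (is "?L \<longleftrightarrow> ?R")
  proof
    assume ?L
    then obtain a m where "a \<in> {- int q..<int q}" and n: "int n = a + int P * int m"
      by (elim bexE exE)
    then have a: "- int q \<le> a" "a < int q" by auto
    show ?R
    proof (cases "a \<ge> 0")
      case True
      then have "n = nat a + P * m"
        using n by (metis int_nat_eq of_nat_add of_nat_eq_iff of_nat_mult)
      then have "n mod P = nat a" using a True P by simp
      then show ?thesis using a True by auto
    next
      case False
      then have "m \<noteq> 0" using n by (metis of_nat_0_le_iff mult_zero_right of_nat_0 add_0_right)
      then obtain m' where m: "m = Suc m'" using not0_implies_Suc by blast
      have "int n = int (nat (int P + a)) + int P * int m'"
        using n a P unfolding m by (simp add: algebra_simps)
      then have "n = nat (int P + a) + P * m'"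
        by (metis of_nat_add of_nat_eq_iff of_nat_mult)
      moreover have "nat (int P + a) < P" using False P by simp
      ultimately have "n mod P = nat (int P + a)" by simp
      then show ?thesis using a P by (auto simp: le_nat_iff of_nat_diff)
    qed
  next
    assume ?R
    then show ?L
    proof
      assume "n mod P < q"
      moreover have "int n = int (n mod P) + int P * int (n div P)"
        by (metis mod_mult_div_eq of_nat_add of_nat_mult)
      ultimately show ?L
        by (intro bexI[of _ "int (n mod P)"] exI[of _ "n div P"]) auto
    next
      assume "P - q \<le> n mod P"
      moreover have "int n = int (n mod P) + int P * int (n div P)"
        by (metis mod_mult_div_eq of_nat_add of_nat_mult)
      then have "int n = (int (n mod P) - int P) + int P * int (Suc (n div P))"
        by (simp add: algebra_simps)
      moreover have "n mod P < P" using P by simp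
      then have "int (n mod P) - int P \<in> {- int q..<int q}"
        unfolding atLeastLessThan_iff using P \<open>P - q \<le> n mod P\<close> by linarith
      ultimately show ?L by blast
    qed
  qed
  then show ?thesis
    using False by (simp add: oxtoby_M_def P_def q_def)
qed (simp add: oxtoby_M_def)

text \<open>
  Since \<open>M\<^sub>0\<close> is empty, every position is a hole of level \<open>0\<close>.
\<close>

definition hole :: "nat \<Rightarrow> nat \<Rightarrow> bool" where
  "hole K n \<longleftrightarrow> (\<forall>l\<le>K. n \<notin> oxtoby_M p l)"

lemma hole_mono: "hole K n \<Longrightarrow> j \<le> K \<Longrightarrow> hole j n"
  by (auto simp: hole_def)

lemma hole_Suc: "hole (Suc K) n \<longleftrightarrow> hole K n \<and> n \<notin> oxtoby_M p (Suc K)"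
  by (auto simp: hole_def le_Suc_eq)

text \<open>
  The index of the position is \<open>K + 1\<close>, which is odd exactly when \<open>K\<close> is even.
\<close>

lemma oxtoby_at_first_level:
  assumes "hole K n" "n \<in> oxtoby_M p (Suc K)"
  shows "oxtoby p n = even K"
proof -
  have "oxtoby_index p n = Suc K"
    unfolding oxtoby_index_def
  proof (rule the_equality)
    show "1 \<le> Suc K \<and> n \<in> oxtoby_M p (Suc K) - (\<Union>l<Suc K. oxtoby_M p l)"
      using assms by (auto simp: hole_def)
    fix k assume "1 \<le> k \<and> n \<in> oxtoby_M p k - (\<Union>l<k. oxtoby_M p l)"
    then show "k = Suc K"
      using assms by (cases k "Suc K" rule: linorder_cases) (auto simp: hole_def)
  qed
  then show ?thesis
    by (simp add: oxtoby_def even_iff_mod_2_eq_zero mod_Suc)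
qed

lemma less_p_mem_M: "0 < k \<Longrightarrow> n < p k \<Longrightarrow> n \<in> oxtoby_M p k"
  using strict_mono_p[THEN strict_monoD, of k "Suc k"] by (simp add: mem_M_iff)

text \<open>
  All of \<open>[0, p\<^sub>K\<^sub>+\<^sub>1)\<close> lies in \<open>M\<^sub>K\<^sub>+\<^sub>1\<close>, so the holes of level \<open>K\<close> there are filled at step \<open>K + 1\<close>.
\<close>

lemma oxtoby_below_p:
  assumes "n < p (Suc K)" "hole K n"
  shows "oxtoby p n = even K"
  using assms by (intro oxtoby_at_first_level less_p_mem_M) simp_all

lemma ex_first_level: "\<exists>K. hole K n \<and> n \<in> oxtoby_M p (Suc K)"
proof -
  define k where "k = (LEAST k. n \<in> oxtoby_M p k)"
  have "n \<in> oxtoby_M p (Suc n)"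
    using less_p[of "Suc n"] by (intro less_p_mem_M) auto
  then have k: "n \<in> oxtoby_M p k" unfolding k_def by (rule LeastI)
  have l: "n \<notin> oxtoby_M p l" if "l < k" for l
    using that not_less_Least unfolding k_def by blast
  have "k \<noteq> 0" using k by (auto simp: mem_M_iff)
  then obtain K where "k = Suc K" using not0_implies_Suc by blast
  then show ?thesis using k l by (auto simp: hole_def intro!: exI[of _ K])
qed

lemma mem_M_cong_mod:
  assumes "l \<le> K" "n mod p (Suc K) = n' mod p (Suc K)"
  shows "n \<in> oxtoby_M p l \<longleftrightarrow> n' \<in> oxtoby_M p l"
proof -
  have "p (Suc l) dvd p (Suc K)" using assms(1) by (intro p_dvd) simp
  then have "n mod p (Suc l) = n' mod p (Suc l)"
    by (metis assms(2) mod_mod_cancel)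
  then show ?thesis by (simp add: mem_M_iff)
qed

lemma hole_cong_mod:
  "n mod p (Suc K) = n' mod p (Suc K) \<Longrightarrow> hole K n \<longleftrightarrow> hole K n'"
  using mem_M_cong_mod unfolding hole_def by blast

text \<open>
  The first \<open>K\<close> levels are unions of residue classes modulo \<open>p\<^sub>K\<^sub>+\<^sub>1\<close>; a position that they fill has
  its symbol determined by its residue.
\<close>

lemma oxtoby_cong_mod:
  assumes "n mod p (Suc K) = n' mod p (Suc K)" "\<not> hole K n"
  shows "oxtoby p n = oxtoby p n'"
proof -
  obtain j where j: "hole j n" "n \<in> oxtoby_M p (Suc j)"
    using ex_first_level by blast
  then have "Suc j \<le> K"
    using assms(2) hole_mono by (meson not_less_eq_eq)
  then have "\<And>l. l \<le> Suc j \<Longrightarrow> n \<in> oxtoby_M p l \<longleftrightarrow> n' \<in> oxtoby_M p l"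
    using mem_M_cong_mod[OF _ assms(1)] by simp
  then have "hole j n'" "n' \<in> oxtoby_M p (Suc j)"
    using j by (auto simp: hole_def)
  then show ?thesis using j oxtoby_at_first_level by metis
qed

text \<open>
  Both \<open>p\<^sub>l\<close> and \<open>p\<^sub>l\<^sub>+\<^sub>1\<close> are multiples of \<open>p\<^sub>K\<^sub>+\<^sub>1\<close> when \<open>l > K\<close>, so higher levels are unions of whole
  blocks of length \<open>p\<^sub>K\<^sub>+\<^sub>1\<close>.
\<close>

lemma mem_M_cong_div:
  assumes "K < l" "n div p (Suc K) = n' div p (Suc K)"
  shows "n \<in> oxtoby_M p l \<longleftrightarrow> n' \<in> oxtoby_M p l"
proof -
  define P where "P = p (Suc K)"
  have P: "P > 0" using p_pos by (simp add: P_def)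
  have "P dvd p l" "P dvd p (Suc l)"
    using assms(1) unfolding P_def by (auto intro: p_dvd)
  then obtain a b where ab: "p l = P * a" "p (Suc l) = P * b"
    by (auto elim!: dvdE)
  have "m mod (P * b) < P * a \<longleftrightarrow> m div P mod b < a" for m
  proof -
    have "m mod (P * b) < P * a \<longleftrightarrow> m mod (P * b) div P < a"
      using P by (simp add: div_less_iff_less_mult mult.commute)
    also have "m mod (P * b) div P = m div P mod b"
      using P by (simp add: mod_mult2_eq)
    finally show ?thesis .
  qed
  moreover have "P * b - P * a \<le> m mod (P * b) \<longleftrightarrow> b - a \<le> m div P mod b" for m
  proof -
    have "P * b - P * a \<le> m mod (P * b) \<longleftrightarrow> b - a \<le> m mod (P * b) div P"
      using P by (simp add: less_eq_div_iff_mult_less_eq mult.commute[of _ P] diff_mult_distrib2)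
    also have "m mod (P * b) div P = m div P mod b"
      using P by (simp add: mod_mult2_eq)
    finally show ?thesis .
  qed
  ultimately show ?thesis
    using assms(2) by (simp add: mem_M_iff ab P_def[symmetric])
qed

text \<open>
  Two holes of level \<open>K\<close> in one block are met by the same higher levels, hence filled by the
  same symbol.
\<close>

lemma oxtoby_cong_div:
  assumes "n div p (Suc K) = n' div p (Suc K)" "hole K n" "hole K n'"
  shows "oxtoby p n = oxtoby p n'"
proof -
  obtain j where j: "hole j n" "n \<in> oxtoby_M p (Suc j)"
    using ex_first_level by blast
  have "K \<le> j"
    using j(2) assms(2) by (force simp: hole_def not_less_eq_eq)
  have M: "n \<in> oxtoby_M p l \<longleftrightarrow> n' \<in> oxtoby_M p l" for l
    using mem_M_cong_div[OF _ assms(1), of l] assms(2,3) by (cases "K < l") (auto simp: hole_def)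
  then have "hole j n'" "n' \<in> oxtoby_M p (Suc j)"
    using j by (auto simp: hole_def)
  then show ?thesis using j oxtoby_at_first_level by metis
qed

text \<open>
  Passing from a position in the first block of level \<open>K\<close> to one with the same residue in the
  first block of level \<open>K + 2\<close>: a position filled early keeps its symbol; a hole is filled at
  step \<open>K + 1\<close> or at step \<open>K + 3\<close>, of the same parity, except when it falls into \<open>M\<^sub>K\<^sub>+\<^sub>2\<close>.
\<close>

lemma oxtoby_lift_eq:
  assumes z: "z' mod p (Suc K) = z" "z + i < p (Suc K)" "z' + i < p (Suc (Suc (Suc K)))"
    and M: "z' + i \<notin> oxtoby_M p (Suc (Suc K))"
  shows "oxtoby p (z' + i) = oxtoby p (z + i)"
proof -
  have mod: "(z' + i) mod p (Suc K) = (z + i) mod p (Suc K)"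
    using z(1) by (metis mod_add_left_eq)
  show ?thesis
  proof (cases "hole K (z + i)")
    case False
    then show ?thesis using oxtoby_cong_mod mod by metis
  next
    case True
    then have hole: "hole K (z' + i)" using hole_cong_mod[OF mod] by simp
    have "oxtoby p (z' + i) = even K"
    proof (cases "z' + i \<in> oxtoby_M p (Suc K)")
      case True
      then show ?thesis using hole by (intro oxtoby_at_first_level)
    next
      case False
      then have "hole (Suc (Suc K)) (z' + i)" using hole M by (simp add: hole_Suc)
      then show ?thesis using oxtoby_below_p[OF z(3)] by simp
    qed
    then show ?thesis using oxtoby_below_p[OF z(2) True] by simp
  qed
qed

lemma card_window_M:
  assumes "0 < l" "p (Suc l) dvd N"
  shows "real (card {j. j < N \<and> n + j \<in> oxtoby_M p l}) = real N * (2 * real (p l) / real (p (Suc l)))"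
proof -
  define P q B where "P = p (Suc l)" and "q = p l" and "B = {r. r < q \<or> P - q \<le> r}"
  have P: "P > 0" "3 * q \<le> P" using p_pos p_ratio by (auto simp: P_def q_def)
  have "B \<inter> {..<P} = {..<q} \<union> {P - q..<P}"
    using P by (auto simp: B_def)
  moreover have "{..<q} \<inter> {P - q..<P} = {}" using P by auto
  ultimately have "card (B \<inter> {..<P}) = 2 * q"
    using P by (simp add: card_Un_disjoint)
  moreover have "{j. j < N \<and> n + j \<in> oxtoby_M p l} = {j. j < N \<and> (n + j) mod P \<in> B}"
    using assms(1) by (auto simp: mem_M_iff B_def P_def q_def)
  ultimately have "card {j. j < N \<and> n + j \<in> oxtoby_M p l} = N div P * (2 * q)"
    using card_window_mod[of P N n B] assms(2) P by (simp add: P_def)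
  then show ?thesis
    using assms(2) by (simp add: P_def q_def real_of_nat_div)
qed

lemma card_window_not_hole:
  assumes "p (Suc K) dvd N"
  shows "real (card {j. j < N \<and> \<not> hole K (n + j)})
    \<le> real N * (\<Sum>l<K. 2 * real (p (Suc l)) / real (p (Suc (Suc l))))"
  using assms
proof (induction K)
  case 0
  then show ?case by (simp add: hole_def mem_M_iff)
next
  case (Suc K)
  have "p (Suc K) dvd N" using Suc.prems p_dvd_Suc dvd_trans by blast
  note IH = Suc.IH[OF this]
  have "{j. j < N \<and> \<not> hole (Suc K) (n + j)} \<subseteq>
    {j. j < N \<and> \<not> hole K (n + j)} \<union> {j. j < N \<and> n + j \<in> oxtoby_M p (Suc K)}"
    by (auto simp: hole_Suc)
  then have "card {j. j < N \<and> \<not> hole (Suc K) (n + j)} \<le>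
    card {j. j < N \<and> \<not> hole K (n + j)} + card {j. j < N \<and> n + j \<in> oxtoby_M p (Suc K)}"
    by (intro order.trans[OF card_mono card_Un_le]) auto
  then have "real (card {j. j < N \<and> \<not> hole (Suc K) (n + j)}) \<le>
    real (card {j. j < N \<and> \<not> hole K (n + j)}) + real (card {j. j < N \<and> n + j \<in> oxtoby_M p (Suc K)})"
    by linarith
  also have "\<dots> \<le> real N * (\<Sum>l<K. 2 * real (p (Suc l)) / real (p (Suc (Suc l))))
      + real N * (2 * real (p (Suc K)) / real (p (Suc (Suc K))))"
    using IH card_window_M[OF _ Suc.prems, of n] by simp
  finally show ?case by (simp add: algebra_simps)
qed

section \<open>Minimality and frequencies\<close>

abbreviation X :: "(nat \<Rightarrow> bool) set" where
  "X \<equiv> orbit_closure (oxtoby p)"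

lemma shift_space_X: "shift_space X"
proof -
  have "oxtoby p \<in> X"
    unfolding mem_orbit_closure_iff by (intro allI exI[of _ 0]) simp
  moreover have "closed X" unfolding orbit_closure_def by (rule closed_closure)
  moreover have "shift y \<in> X" if y: "y \<in> X" for y
    unfolding mem_orbit_closure_iff
  proof
    fix W
    obtain n where "\<forall>i<Suc W. y i = oxtoby p (n + i)"
      using y[unfolded mem_orbit_closure_iff, rule_format, of "Suc W"] by (elim exE)
    then have "\<forall>i<W. shift y i = oxtoby p (Suc n + i)"
      by (simp add: shift_def)
    then show "\<exists>n. \<forall>i<W. shift y i = oxtoby p (n + i)" ..
  qed
  ultimately show ?thesis
    unfolding shift_space_def by (metis emptyE image_subsetI)
qed

lemma funpow_shift_mem: "shift ` Y \<subseteq> Y \<Longrightarrow> y \<in> Y \<Longrightarrow> (shift ^^ n) y \<in> Y"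
proof (induction n)
  case (Suc n)
  show ?case
    using subsetD[OF Suc.prems(1) imageI[OF Suc.IH[OF Suc.prems]]] by simp
qed simp

text \<open>
  A prefix of \<open>x\<close> of length below \<open>p\<^sub>k\<close> is filled within \<open>k\<close> steps, so it recurs at all multiples of
  \<open>p\<^sub>k\<^sub>+\<^sub>1\<close>. Hence each point of the orbit closure shows the prefix after a bounded number of
  shifts, and \<open>x\<close> lies in every nonempty subsystem.
\<close>

lemma minimal_shift_space_X: "minimal_shift_space X"
  unfolding minimal_shift_space_def
proof (intro conjI allI impI)
  fix Y assume Y: "shift_space Y \<and> Y \<subseteq> X"
  then have Y': "closed Y" "shift ` Y \<subseteq> Y" "Y \<noteq> {}" "Y \<subseteq> X"
    by (simp_all only: shift_space_def not_False_eq_True)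
  from Y'(3) obtain y where y: "y \<in> Y" by (rule ex_in_conv[THEN iffD2, THEN exE])
  then have "y \<in> X" using Y'(4) by (rule rev_subsetD)
  have "oxtoby p \<in> closure Y"
    unfolding closure_iff_cylinder
  proof
    fix W
    define P where "P = p (Suc (Suc W))"
    have P: "P > 0" by (simp add: P_def p_pos)
    obtain n where n: "\<forall>i<P + W. y i = oxtoby p (n + i)"
      using \<open>y \<in> X\<close>[unfolded mem_orbit_closure_iff, rule_format, of "P + W"] by (elim exE)
    \<comment> \<open>Shifting by \<open>m\<close> moves the starting point \<open>n\<close> to the next multiple of the period.\<close>
    define m where "m = P - n mod P"
    have m: "m \<le> P" "(n + m) mod P = 0"
    proof -
      have "n + m = n div P * P + P"
        using P mod_less_divisor[OF P, of n] unfolding m_def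
        by (metis add.assoc le_add_diff_inverse less_imp_le_nat div_mult_mod_eq)
      then show "(n + m) mod P = 0" by simp
    qed (simp add: m_def)
    have "(shift ^^ m) y i = oxtoby p i" if i: "i < W" for i
    proof -
      have "i < p (Suc W)" using i less_p[of "Suc W"] by simp
      then have "\<not> hole (Suc W) i"
        using less_p_mem_M[of "Suc W" i] by (auto simp: hole_def)
      moreover have "i mod P = (n + (m + i)) mod P"
        using m(2) by (metis add.assoc mod_add_left_eq add_0)
      ultimately have "oxtoby p i = oxtoby p (n + (m + i))"
        unfolding P_def by (rule oxtoby_cong_mod[rotated])
      then show ?thesis using n i m(1) by (simp add: funpow_shift)
    qed
    then show "\<exists>z\<in>Y. \<forall>i<W. z i = oxtoby p i"
      using funpow_shift_mem[OF Y'(2) y] by (intro bexI[of _ "(shift ^^ m) y"]) simp_all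
  qed
  then have "oxtoby p \<in> Y" using Y'(1) by simp
  then have "X \<subseteq> Y"
    unfolding orbit_closure_def using funpow_shift_mem[OF Y'(2) \<open>oxtoby p \<in> Y\<close>] Y'(1)
    by (intro closure_minimal) (rule image_subsetI)
  then show "Y = X" using Y'(4) by (intro equalityI)
qed (rule shift_space_X)

end

context oxtoby_scale
begin

text \<open>
  The probability of a finitary event is the mean of its frequency along the first \<open>N\<close> shifts.
  For a point of the orbit closure this frequency is read off a finite window, and that window
  occurs in \<open>x\<close>. So a bound on frequencies in all windows of \<open>x\<close> of one length bounds the
  probability, for every invariant measure at once.
\<close>

lemma measure_le_window_frequency:
  assumes \<mu>: "\<mu> \<in> invariant_measures X" and C: "finitary C" and N: "N > 0"
    and freq: "\<And>n. real (card {j. j < N \<and> n + j \<in> B}) \<le> real N * c"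
    and B: "\<And>n. n \<notin> B \<Longrightarrow> (shift ^^ n) (oxtoby p) \<notin> C"
  shows "measure \<mu> C \<le> c"
proof -
  have sets: "sets \<mu> = sets borel" and inv: "distr \<mu> borel shift = \<mu>" and X1: "emeasure \<mu> X = 1"
    and "prob_space \<mu>"
    using \<mu> by (auto simp: invariant_measures_def)
  interpret prob_space \<mu> by fact
  have [measurable_cong]: "sets \<mu> = sets borel" by (fact sets)
  have space: "space \<mu> = UNIV" using sets_eq_imp_space_eq[OF sets] by simp
  have [measurable]: "C \<in> sets borel" using C by (rule finitary_borel)
  have funpow [measurable]: "(shift ^^ j) \<in> borel_measurable borel" for j
    by (induction j) (simp_all add: id_def[symmetric] measurable_comp[OF _ shift_measurable])
  have events: "{y. (shift ^^ j) y \<in> C} \<in> events" for j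
    using measurable_sets[OF funpow \<open>C \<in> sets borel\<close>, of j] by (simp add: sets vimage_def)
  have integrable: "integrable \<mu> (indicator {y. (shift ^^ j) y \<in> C} :: _ \<Rightarrow> real)" for j
    using events[of j] by (intro integrable_real_indicator) (simp_all add: less_top[symmetric])
  have prob_funpow: "prob {y. (shift ^^ j) y \<in> C} = prob C" for j
  proof (induction j)
    case (Suc j)
    have "prob {y. (shift ^^ j) y \<in> C} = measure (distr \<mu> borel shift) {y. (shift ^^ j) y \<in> C}"
      by (simp only: inv)
    also have "\<dots> = prob (shift -` {y. (shift ^^ j) y \<in> C} \<inter> space \<mu>)"
      by (rule measure_distr) measurable
    also have "shift -` {y. (shift ^^ j) y \<in> C} \<inter> space \<mu> = {y. (shift ^^ Suc j) y \<in> C}"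
      by (auto simp: space funpow_swap1)
    finally show ?case using Suc.IH by simp
  qed simp
  obtain W where W: "depends_on W C"
    using C unfolding finitary_def by (elim exE)
  have count: "(\<Sum>j<N. indicator {y. (shift ^^ j) y \<in> C} y) \<le> real N * c" if y: "y \<in> X" for y
  proof -
    obtain n where n: "\<forall>i<N + W. y i = oxtoby p (n + i)"
      using y[unfolded mem_orbit_closure_iff, rule_format, of "N + W"] by (elim exE)
    have sub: "{j. j < N \<and> (shift ^^ j) y \<in> C} \<subseteq> {j. j < N \<and> n + j \<in> B}"
    proof (intro subsetI CollectI conjI)
      fix j assume j: "j \<in> {j. j < N \<and> (shift ^^ j) y \<in> C}"
      then show "j < N" by simp
      have "(shift ^^ j) y \<in> C \<longleftrightarrow> (shift ^^ (n + j)) (oxtoby p) \<in> C"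
        by (rule depends_onD[OF W]) (use j n in \<open>simp add: funpow_shift add.assoc\<close>)
      then show "n + j \<in> B" using j B by auto
    qed
    have "(\<Sum>j<N. indicator {y. (shift ^^ j) y \<in> C} y) = real (card {j. j < N \<and> (shift ^^ j) y \<in> C})"
      by (simp add: indicator_def sum_of_bool_eq Int_def)
    also have "\<dots> \<le> real (card {j. j < N \<and> n + j \<in> B})"
      using card_mono[OF _ sub] by simp
    finally show ?thesis using freq[of n] by simp
  qed
  have ae: "AE y in \<mu>. y \<in> X"
  proof -
    have "X \<in> events" by (simp add: sets orbit_closure_def)
    then show ?thesis using X1 by (simp add: AE_in_set_eq_1 emeasure_eq_measure)
  qed
  have "real N * prob C = (\<Sum>j<N. prob {y. (shift ^^ j) y \<in> C})"
    by (simp add: prob_funpow)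
  also have "\<dots> = (\<Sum>j<N. \<integral>y. indicator {y. (shift ^^ j) y \<in> C} y \<partial>\<mu>)"
    by (simp add: space)
  also have "\<dots> = (\<integral>y. (\<Sum>j<N. indicator {y. (shift ^^ j) y \<in> C} y) \<partial>\<mu>)"
    by (rule Bochner_Integration.integral_sum[symmetric]) (rule integrable)
  also have "\<dots> \<le> (\<integral>y. real N * c \<partial>\<mu>)"
  proof (rule integral_mono_AE)
    show "AE y in \<mu>. (\<Sum>j<N. indicator {y. (shift ^^ j) y \<in> C} y) \<le> real N * c"
      using ae by eventually_elim (rule count)
  qed (simp_all add: integrable)
  also have "\<dots> = real N * c" by (simp add: prob_space)
  finally show ?thesis using N by simp
qed

end

section \<open>Distance of the Oxtoby sequence to the constant sequences\<close>

text \<open>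
  The bound \<open>S < 1 / 2\<close> makes the holes of every level a strict majority in each window of
  length one period.
\<close>

locale thin_oxtoby = oxtoby_scale +
  fixes S :: real
  assumes sums_S: "(\<lambda>k. 2 * real (p (Suc k)) / real (p (Suc (Suc k)))) sums S"
    and S_less: "S < 1 / 2"
begin

definition gap :: "nat \<Rightarrow> real" where
  "gap k = real (p (Suc k)) / real (p (Suc (Suc k)))"

lemma summable_gap: "summable gap"
proof -
  have "summable (\<lambda>k. (1 / 2) * (2 * real (p (Suc k)) / real (p (Suc (Suc k)))))"
    using sums_S by (intro summable_mult) (simp add: sums_iff)
  then show ?thesis by (simp add: gap_def[abs_def])
qed

lemma gap_tendsto: "gap \<longlonglongrightarrow> 0"
  using summable_gap by (rule summable_LIMSEQ_zero)

lemma card_window_not_hole_le: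
  assumes "p (Suc K) dvd N"
  shows "real (card {j. j < N \<and> \<not> hole K (n + j)}) \<le> real N * S"
proof -
  have "(\<Sum>l<K. 2 * real (p (Suc l)) / real (p (Suc (Suc l)))) \<le> S"
    using sums_S by (auto simp: sums_iff intro!: sum_le_suminf)
  then show ?thesis
    using card_window_not_hole[OF assms, of n] by (meson order.trans mult_left_mono of_nat_0_le_iff)
qed

lemma card_window_hole_ge:
  assumes "p (Suc K) dvd N"
  shows "real N * (1 - S) \<le> real (card {j. j < N \<and> hole K (n + j)})"
proof -
  have "{..<N} = {j. j < N \<and> hole K (n + j)} \<union> {j. j < N \<and> \<not> hole K (n + j)}" by auto
  then have "N \<le> card {j. j < N \<and> hole K (n + j)} + card {j. j < N \<and> \<not> hole K (n + j)}"
    by (metis card_Un_le card_lessThan)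
  then show ?thesis
    using card_window_not_hole_le[OF assms, of n] by (simp add: algebra_simps)
qed

text \<open>
  The prefixes of length \<open>p\<^sub>K\<^sub>+\<^sub>1\<close> with \<open>K\<close> of the parity that fills holes with the symbol other
  than \<open>b\<close> differ from \<open>b\<close> at all holes, and the upper density sees these prefixes.
\<close>

lemma dbar_oxtoby_const_ge: "ereal (1 - S) \<le> dbar (oxtoby p) (\<lambda>_. b)"
proof -
  define u where "u n = ereal (real (card {j. j < n \<and> oxtoby p j \<noteq> b}) / real n)" for n
  define k where "k j = 2 * j + (if b then 1 else 0)" for j :: nat
  define r where "r j = p (Suc (k j))" for j
  have "strict_mono r"
    unfolding r_def k_def strict_mono_Suc_iff
    by (auto intro!: strict_mono_p[THEN strict_monoD])
  have "ereal (1 - S) \<le> (u \<circ> r) j" for j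
  proof -
    have "oxtoby p n \<noteq> b" if "n < r j" "hole (k j) n" for n
      using oxtoby_below_p[of n "k j"] that by (auto simp: r_def k_def)
    then have "card {n. n < r j \<and> hole (k j) n} \<le> card {n. n < r j \<and> oxtoby p n \<noteq> b}"
      by (intro card_mono) auto
    then have "real (r j) * (1 - S) \<le> real (card {n. n < r j \<and> oxtoby p n \<noteq> b})"
      using card_window_hole_ge[of "k j" "r j" 0] by (simp add: r_def)
    then show ?thesis
      using p_pos[of "Suc (k j)"] by (simp add: u_def r_def field_simps)
  qed
  then have "ereal (1 - S) \<le> limsup (u \<circ> r)"
    by (intro le_Limsup) simp_all
  also have "\<dots> \<le> limsup u"
    by (rule limsup_subseq_mono) fact
  finally show ?thesis by (simp add: dbar_def u_def[abs_def])
qed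

section \<open>Majority symbols and the nearby measure on constant sequences\<close>

text \<open>
  For \<open>n\<close> outside this set the window of length \<open>p\<^sub>K\<^sub>+\<^sub>1\<close> starting at \<open>n\<close> avoids \<open>M\<^sub>K\<^sub>+\<^sub>1\<close> and stays inside
  one block of length \<open>p\<^sub>K\<^sub>+\<^sub>2\<close>; the factor 2 leaves room for the length of the window.
\<close>

definition bad :: "nat \<Rightarrow> nat set" where
  "bad K = {n. n mod p (Suc (Suc K)) < p (Suc K) \<or>
     p (Suc (Suc K)) - 2 * p (Suc K) \<le> n mod p (Suc (Suc K))}"

lemma card_window_bad_le:
  assumes "p (Suc (Suc K)) dvd N"
  shows "real (card {j. j < N \<and> n + j \<in> bad K}) \<le> real N * (3 * gap K)"
proof -
  define P q B where "P = p (Suc (Suc K))" and "q = p (Suc K)" and "B = {r. r < q \<or> P - 2 * q \<le> r}"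
  have P: "P > 0" using p_pos by (auto simp: P_def)
  have "B \<inter> {..<P} \<subseteq> {..<q} \<union> {P - 2 * q..<P}"
    by (auto simp: B_def)
  then have "card (B \<inter> {..<P}) \<le> card {..<q} + card {P - 2 * q..<P}"
    by (intro order.trans[OF card_mono card_Un_le]) auto
  then have B: "card (B \<inter> {..<P}) \<le> 3 * q" by simp
  have "card {j. j < N \<and> n + j \<in> bad K} = N div P * card (B \<inter> {..<P})"
    using card_window_mod[of P N n B] assms P by (simp add: bad_def B_def P_def q_def)
  also have "\<dots> \<le> N div P * (3 * q)"
    using B by (rule mult_le_mono2)
  finally have "real (card {j. j < N \<and> n + j \<in> bad K}) \<le> real (N div P * (3 * q))"
    by (simp only: of_nat_le_iff)
  also have "\<dots> = real N * (3 * gap K)"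
    using assms by (simp add: P_def q_def gap_def real_of_nat_div)
  finally show ?thesis .
qed

lemma holes_in_good_window:
  assumes n: "n \<notin> bad K" and i: "i < p (Suc K)" "hole K (n + i)"
  shows "hole (Suc K) (n + i)" "(n + i) div p (Suc (Suc K)) = n div p (Suc (Suc K))"
proof -
  define P q where "P = p (Suc (Suc K))" and "q = p (Suc K)"
  have P: "P > 0" "n mod P \<ge> q" "n mod P < P - 2 * q"
    using p_pos n by (auto simp: P_def q_def bad_def not_less not_le)
  then have lt: "n mod P + i < P - q" using i(1) by (auto simp: q_def)
  have eq: "n + i = n div P * P + (n mod P + i)" by (simp add: add.assoc[symmetric])
  have "(n + i) mod P = n mod P + i"
    using lt by (subst eq) (simp only: mod_mult_self3 mod_less)
  moreover have "(n + i) div P = n div P"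
    using lt P(1) by (subst eq) (simp only: div_mult_self3 div_less)
  ultimately show "hole (Suc K) (n + i)" "(n + i) div p (Suc (Suc K)) = n div p (Suc (Suc K))"
    using lt P(2) i(2) by (auto simp: hole_Suc mem_M_iff P_def[symmetric] q_def[symmetric])
qed

lemma oxtoby_const_on_good_window:
  assumes "n \<notin> bad K" "i < p (Suc K)" "hole K (n + i)" "j < p (Suc K)" "hole K (n + j)"
  shows "oxtoby p (n + i) = oxtoby p (n + j)"
  using holes_in_good_window[OF assms(1)] assms(2-5) by (intro oxtoby_cong_div[of _ "Suc K"]) simp_all

lemma most_are_holes: "p (Suc K) < 2 * card {j. j < p (Suc K) \<and> hole K (n + j)}"
proof -
  define L where "L = p (Suc K)"
  have "real L * (1 / 2) < real L * (1 - S)"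
    using S_less p_pos[of "Suc K"] unfolding L_def by (intro mult_strict_left_mono) auto
  then have "real L < 2 * real (card {j. j < L \<and> hole K (n + j)})"
    using card_window_hole_ge[of K L n] unfolding L_def by auto
  then show ?thesis unfolding L_def by linarith
qed

text \<open>
  A hole other than the starting point is needed, because such a hole also lies in the window
  that starts one step later.
\<close>

lemma ex_hole: "\<exists>i. 0 < i \<and> i < p (Suc K) \<and> hole K (n + i)"
proof (rule ccontr)
  assume "\<nexists>i. 0 < i \<and> i < p (Suc K) \<and> hole K (n + i)"
  then have "{j. j < p (Suc K) \<and> hole K (n + j)} \<subseteq> {0}" by auto
  then have "card {j. j < p (Suc K) \<and> hole K (n + j)} \<le> 1"
    using card_mono[of "{0::nat}"] by simp
  then show False
    using most_are_holes[of K n] p_ratio[of K] p_pos[of K] by linarith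
qed

definition majority :: "nat \<Rightarrow> (nat \<Rightarrow> bool) set" where
  "majority K = {y. p (Suc K) < 2 * card {i. i < p (Suc K) \<and> y i}}"

lemma finitary_majority: "finitary (majority K)"
proof (rule finitaryI[of "p (Suc K)"])
  fix y z :: "nat \<Rightarrow> bool" assume "\<And>i. i < p (Suc K) \<Longrightarrow> y i = z i"
  then have "{i. i < p (Suc K) \<and> y i} = {i. i < p (Suc K) \<and> z i}" by auto
  then show "y \<in> majority K \<longleftrightarrow> z \<in> majority K" by (simp add: majority_def)
qed

text \<open>
  In a good window all holes of level \<open>K\<close> carry one symbol, and they outnumber the rest.
\<close>

lemma majority_good_window:
  assumes n: "n \<notin> bad K" and i: "i < p (Suc K)" "hole K (n + i)"
  shows "(shift ^^ n) (oxtoby p) \<in> majority K \<longleftrightarrow> oxtoby p (n + i)"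
proof -
  define L where "L = p (Suc K)"
  define A where "A b = {j. j < L \<and> oxtoby p (n + j) = b}" for b
  have "{j. j < L \<and> hole K (n + j)} \<subseteq> A (oxtoby p (n + i))"
    using oxtoby_const_on_good_window[OF n _ _ i] by (auto simp: A_def L_def)
  then have "card {j. j < L \<and> hole K (n + j)} \<le> card (A (oxtoby p (n + i)))"
    by (intro card_mono) (auto simp: A_def)
  then have most: "L < 2 * card (A (oxtoby p (n + i)))"
    using most_are_holes[of K n] unfolding L_def by linarith
  have "card (A True) + card (A False) = card (A True \<union> A False)"
    by (intro card_Un_disjoint[symmetric]) (auto simp: A_def)
  also have "A True \<union> A False = {..<L}" by (auto simp: A_def)
  finally have "card (A True) + card (A False) = L" by simp
  moreover have "(shift ^^ n) (oxtoby p) \<in> majority K \<longleftrightarrow> L < 2 * card (A True)"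
    by (simp add: majority_def L_def A_def funpow_shift)
  ultimately show ?thesis using most by (cases "oxtoby p (n + i)") auto
qed

definition unstable :: "nat \<Rightarrow> (nat \<Rightarrow> bool) set" where
  "unstable K = {y. \<not> ((y \<in> majority K \<longleftrightarrow> y \<in> majority (Suc K)) \<and> (y \<in> majority K \<longleftrightarrow> shift y \<in> majority K))}"

lemma finitary_unstable: "finitary (unstable K)"
  unfolding unstable_def
  by (rule finitary_binop[where op = "\<lambda>a b. \<not> (a \<and> b)"];
      rule finitary_binop[where op = "(\<longleftrightarrow>)"])
    (simp_all add: finitary_majority finitary_shift)

text \<open>
  The three majorities concern windows with a common hole, and each equals the symbol there.
\<close>

lemma not_unstable:
  assumes "n \<notin> bad K" "Suc n \<notin> bad K" "n \<notin> bad (Suc K)"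
  shows "(shift ^^ n) (oxtoby p) \<notin> unstable K"
proof -
  obtain i where i: "0 < i" "i < p (Suc K)" "hole K (n + i)"
    using ex_hole by blast
  have i': "i < p (Suc (Suc K))" using i(2) p_ratio[of "Suc K"] by simp
  have "(shift ^^ n) (oxtoby p) \<in> majority K \<longleftrightarrow> oxtoby p (n + i)"
    using assms(1) i by (intro majority_good_window)
  moreover have "(shift ^^ n) (oxtoby p) \<in> majority (Suc K) \<longleftrightarrow> oxtoby p (n + i)"
    using assms(3) i' holes_in_good_window(1)[OF assms(1) i(2,3)] by (intro majority_good_window)
  moreover have "(shift ^^ Suc n) (oxtoby p) \<in> majority K \<longleftrightarrow> oxtoby p (Suc n + (i - 1))"
    using assms(2) i by (intro majority_good_window) auto
  ultimately show ?thesis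
    using i(1) by (simp add: unstable_def)
qed

lemma measure_unstable_le:
  assumes \<mu>: "\<mu> \<in> invariant_measures X"
  shows "measure \<mu> (unstable K) \<le> 6 * gap K + 3 * gap (Suc K)"
proof (rule measure_le_window_frequency[OF \<mu> finitary_unstable])
  define N where "N = p (Suc (Suc (Suc K)))"
  show "N > 0" by (simp add: N_def p_pos)
  have dvd: "p (Suc (Suc K)) dvd N" "p (Suc (Suc (Suc K))) dvd N"
    by (simp_all add: N_def p_dvd_Suc)
  define B where "B = {n. n \<in> bad K \<or> Suc n \<in> bad K \<or> n \<in> bad (Suc K)}"
  show "(shift ^^ n) (oxtoby p) \<notin> unstable K" if "n \<notin> B" for n
    using that by (intro not_unstable) (auto simp: B_def)
  fix n
  have "{j. j < N \<and> n + j \<in> B} \<subseteq> {j. j < N \<and> n + j \<in> bad K} \<union>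
      {j. j < N \<and> Suc n + j \<in> bad K} \<union> {j. j < N \<and> n + j \<in> bad (Suc K)}"
    by (auto simp: B_def)
  then have "card {j. j < N \<and> n + j \<in> B} \<le> card {j. j < N \<and> n + j \<in> bad K} +
      card {j. j < N \<and> Suc n + j \<in> bad K} + card {j. j < N \<and> n + j \<in> bad (Suc K)}"
    by (intro order.trans[OF card_mono order.trans[OF card_Un_le add_mono[OF card_Un_le order.refl]]]) auto
  then have "real (card {j. j < N \<and> n + j \<in> B}) \<le> real N * (3 * gap K) + real N * (3 * gap K) + real N * (3 * gap (Suc K))"
    using card_window_bad_le[OF dvd(1), of n] card_window_bad_le[OF dvd(1), of "Suc n"]
      card_window_bad_le[OF dvd(2), of n] by linarith
  then show "real (card {j. j < N \<and> n + j \<in> B}) \<le> real N * (6 * gap K + 3 * gap (Suc K))"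
    by (simp add: algebra_simps)
qed

text \<open>
  The symbol at the origin is the majority symbol unless the origin is filled within \<open>K\<close> steps,
  which has frequency at most \<open>S\<close>, or the window is bad.
\<close>

lemma measure_disagree_le:
  assumes \<mu>: "\<mu> \<in> invariant_measures X"
  shows "measure \<mu> {y. y 0 \<noteq> (y \<in> majority K)} \<le> S + 3 * gap K"
proof (rule measure_le_window_frequency[OF \<mu>])
  show "finitary {y. y 0 \<noteq> (y \<in> majority K)}"
    by (rule finitary_binop[where op = "(\<noteq>)"]) (simp_all add: finitary_majority finitary_coord)
  define N where "N = p (Suc (Suc K))"
  show "N > 0" by (simp add: N_def p_pos)
  define B where "B = {n. \<not> hole K n \<or> n \<in> bad K}"
  show "(shift ^^ n) (oxtoby p) \<notin> {y. y 0 \<noteq> (y \<in> majority K)}" if "n \<notin> B" for n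
    using that majority_good_window[of n K 0] p_pos by (auto simp: B_def funpow_shift)
  fix n
  have "{j. j < N \<and> n + j \<in> B} \<subseteq> {j. j < N \<and> \<not> hole K (n + j)} \<union> {j. j < N \<and> n + j \<in> bad K}"
    by (auto simp: B_def)
  then have "card {j. j < N \<and> n + j \<in> B} \<le>
      card {j. j < N \<and> \<not> hole K (n + j)} + card {j. j < N \<and> n + j \<in> bad K}"
    by (intro order.trans[OF card_mono card_Un_le]) auto
  then show "real (card {j. j < N \<and> n + j \<in> B}) \<le> real N * (S + 3 * gap K)"
    using card_window_not_hole_le[of K N n] card_window_bad_le[of K N n]
    by (simp add: N_def p_dvd_Suc algebra_simps)
qed

text \<open>
  The limiting majority symbol is a shift-invariant function up to a null set. The measure
  sought is the law of the corresponding constant sequence, joined with \<open>\<mu>\<close> along the graph.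
\<close>

lemma ex_constant_measure_near:
  assumes \<mu>: "\<mu> \<in> invariant_measures X"
  shows "\<exists>\<nu>\<in>invariant_measures {\<lambda>_. False, \<lambda>_. True}. dbar_measure \<mu> \<nu> \<le> ereal S"
proof -
  have sets: "sets \<mu> = sets borel" and inv: "distr \<mu> borel shift = \<mu>" and "prob_space \<mu>"
    using \<mu> by (auto simp: invariant_measures_def)
  interpret prob_space \<mu> by fact
  have [measurable_cong]: "sets \<mu> = sets borel" by (fact sets)
  have space [simp]: "space \<mu> = UNIV" using sets_eq_imp_space_eq[OF sets] by simp
  have inv': "distr \<mu> \<mu> shift = \<mu>"
    using inv by (metis distr_cong sets)
  have [measurable]: "majority K \<in> sets borel" for K
    by (rule finitary_borel) (rule finitary_majority)
  \<comment> \<open>The event that the limiting majority symbol is 1, as an upper limit so that it is a Borel set.\<close>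
  define A where "A = {y. \<forall>n. \<exists>K\<ge>n. y \<in> majority K}"
  have A [measurable]: "A \<in> sets borel"
  proof -
    have "{y \<in> space borel. \<forall>n. \<exists>K\<ge>n. y \<in> majority K} \<in> sets borel" by measurable
    then show ?thesis by (simp add: A_def)
  qed
  have mem_A: "y \<in> A \<longleftrightarrow> b" if "\<forall>\<^sub>F K in sequentially. y \<in> majority K \<longleftrightarrow> b" for y b
  proof -
    obtain n where n: "\<And>K. K \<ge> n \<Longrightarrow> y \<in> majority K \<longleftrightarrow> b"
      using \<open>\<forall>\<^sub>F K in sequentially. y \<in> majority K \<longleftrightarrow> b\<close> unfolding eventually_sequentially by blast
    show ?thesis
    proof (cases b)
      case True
      have "\<exists>K\<ge>m. y \<in> majority K" for m
        using n[of "max m n"] True by (intro exI[of _ "max m n"]) simp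
      then show ?thesis using True by (simp add: A_def)
    next
      case False
      then have "\<not> (\<exists>K\<ge>n. y \<in> majority K)" using n by blast
      then show ?thesis using False by (auto simp: A_def)
    qed
  qed
  have ae: "AE y in \<mu>. (\<forall>\<^sub>F K in sequentially. y \<in> majority K \<longleftrightarrow> y \<in> A) \<and> (shift y \<in> A \<longleftrightarrow> y \<in> A)"
  proof -
    have "AE y in \<mu>. \<forall>\<^sub>F K in sequentially. y \<in> space \<mu> - unstable K"
    proof (rule borel_cantelli_AE1)
      show "unstable K \<in> events" for K
        using finitary_borel[OF finitary_unstable] by (simp add: sets)
      have "summable (\<lambda>K. 6 * gap K + 3 * gap (Suc K))"
        using summable_gap by (intro summable_add summable_mult) (simp_all only: summable_Suc_iff)
      then show "summable (\<lambda>K. prob (unstable K))"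
        by (rule summable_comparison_test_ev[rotated]) (simp add: measure_unstable_le[OF \<mu>])
    qed (simp add: less_top[symmetric])
    then show ?thesis
    proof eventually_elim
      case (elim y)
      then obtain n where n: "\<And>K. K \<ge> n \<Longrightarrow> y \<notin> unstable K"
        unfolding eventually_sequentially by blast
      define b where "b \<longleftrightarrow> y \<in> majority n"
      have b: "y \<in> majority K \<longleftrightarrow> b" if "K \<ge> n" for K
        using that
      proof (induction rule: dec_induct)
        case (step K)
        then show ?case using n[of K] by (simp add: unstable_def)
      qed (simp add: b_def)
      then have ev: "\<forall>\<^sub>F K in sequentially. y \<in> majority K \<longleftrightarrow> b"
        unfolding eventually_sequentially by blast
      have "shift y \<in> majority K \<longleftrightarrow> b" if "K \<ge> n" for K
        using n[OF that] b[OF that] unfolding unstable_def by blast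
      then have ev': "\<forall>\<^sub>F K in sequentially. shift y \<in> majority K \<longleftrightarrow> b"
        unfolding eventually_sequentially by blast
      show ?case using mem_A[OF ev] mem_A[OF ev'] ev by simp
    qed
  qed
  define g :: "(nat \<Rightarrow> bool) \<Rightarrow> nat \<Rightarrow> bool" where "g y = (\<lambda>_. y \<in> A)" for y
  have g_cases: "g = (\<lambda>y. if y \<in> A then (\<lambda>_. True) else (\<lambda>_. False))"
    by (auto simp: g_def)
  have g: "g \<in> borel_measurable \<mu>"
    unfolding g_cases by measurable
  have shift_g: "AE y in \<mu>. g (shift y) = shift (g y)"
    using ae by eventually_elim (simp add: g_def shift_def)
  define \<nu> where "\<nu> = distr \<mu> borel g"
  have "\<nu> \<in> invariant_measures {\<lambda>_. False, \<lambda>_. True}"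
    unfolding \<nu>_def
  proof (rule distr_mem_invariant_measures[OF \<open>prob_space \<mu>\<close> _ g inv' shift_g])
    show "AE y in \<mu>. g y \<in> {\<lambda>_. False, \<lambda>_. True}" by (auto simp: g_cases)
    show "shift \<in> \<mu> \<rightarrow>\<^sub>M \<mu>" by measurable
  qed (rule closed_constants)
  moreover have "dbar_measure \<mu> \<nu> \<le> ereal S"
  proof -
    have "distr \<mu> borel (\<lambda>y. y) = \<mu>"
      using sets by (simp add: distr_id2)
    moreover have "dbar_measure (distr \<mu> borel (\<lambda>y. y)) (distr \<mu> borel g)
        \<le> ereal (prob {y \<in> space \<mu>. y 0 \<noteq> g y 0})"
    proof (rule dbar_measure_distr_le[OF \<open>prob_space \<mu>\<close> _ _ g inv' _ shift_g])
      show "shift \<in> \<mu> \<rightarrow>\<^sub>M \<mu>" "(\<lambda>y. y) \<in> borel_measurable \<mu>" by measurable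
    qed simp
    ultimately have "dbar_measure \<mu> \<nu> \<le> ereal (prob {y \<in> space \<mu>. y 0 \<noteq> g y 0})"
      by (simp only: \<nu>_def)
    also have "prob {y \<in> space \<mu>. y 0 \<noteq> g y 0} \<le> S"
    proof (rule LIMSEQ_le)
      show "(\<lambda>K. prob {y. y 0 \<noteq> (y \<in> majority K)}) \<longlonglongrightarrow> prob {y \<in> space \<mu>. y 0 \<noteq> g y 0}"
      proof (rule tendsto_prob_of_AE_eventually)
        have [measurable]: "Measurable.pred \<mu> (\<lambda>y. y 0)"
          using finitary_borel[OF finitary_coord] by (simp add: pred_def sets)
        have "{y \<in> space \<mu>. y 0 \<noteq> (y \<in> majority K)} \<in> events" for K
          by measurable
        then show "{y. y 0 \<noteq> (y \<in> majority K)} \<in> events" for K by simp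
        show "{y \<in> space \<mu>. y 0 \<noteq> g y 0} \<in> events"
          unfolding g_def by measurable
        show "AE y in \<mu>. \<forall>\<^sub>F K in sequentially.
            (y \<in> {y. y 0 \<noteq> (y \<in> majority K)}) = (y \<in> {y \<in> space \<mu>. y 0 \<noteq> g y 0})"
          using ae
        proof eventually_elim
          case (elim y)
          then show ?case
            by (auto simp: g_def elim!: eventually_mono)
        qed
      qed
      have "(\<lambda>K. S + 3 * gap K) \<longlonglongrightarrow> S + 3 * 0"
        by (intro tendsto_intros gap_tendsto)
      then show "(\<lambda>K. S + 3 * gap K) \<longlonglongrightarrow> S" by simp
      show "\<exists>N. \<forall>n\<ge>N. prob {y. y 0 \<noteq> (y \<in> majority n)} \<le> S + 3 * gap n"
        using measure_disagree_le[OF \<mu>] by blast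
    qed
    finally show ?thesis by simp
  qed
  ultimately show ?thesis by blast
qed

end

section \<open>A Haar-distributed point of the odometer\<close>

context oxtoby_scale
begin

text \<open>
  Reversal of mixed-radix digits with radices \<open>p\<^sub>k\<^sub>+\<^sub>1 / p\<^sub>k\<close>: the last digit of \<open>m\<close> becomes the
  leading one. It turns the compatibility of the expansions of a real, where truncation drops
  the last digit, into compatibility modulo \<open>p\<^sub>k\<close>.
\<close>

primrec digit_rev :: "nat \<Rightarrow> nat \<Rightarrow> nat" where
  "digit_rev 0 m = 0"
| "digit_rev (Suc k) m =
    digit_rev k (m div (p (Suc k) div p k)) + p k * (m mod (p (Suc k) div p k))"

lemma p_Suc_eq: "p (Suc k) = p k * (p (Suc k) div p k)"
  using p_dvd_Suc by simp

lemma radix_pos: "0 < p (Suc k) div p k"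
  using p_Suc_eq[of k] p_pos[of "Suc k"] by (metis mult_0_right neq0_conv)

lemma digit_rev_less: "digit_rev k m < p k"
proof (induction k arbitrary: m)
  case (Suc k)
  define q where "q = p (Suc k) div p k"
  have "m mod q < q" using radix_pos[of k] by (simp add: q_def)
  then have "p k * Suc (m mod q) \<le> p k * q" by (intro mult_le_mono2) simp
  moreover have "digit_rev k (m div q) < p k" by (rule Suc.IH)
  ultimately show ?case
    using p_Suc_eq[of k] by (simp add: q_def[symmetric])
qed (simp add: p_0)

lemma digit_rev_mod: "digit_rev (Suc k) m mod p k = digit_rev k (m div (p (Suc k) div p k))"
  by (simp add: digit_rev_less)

lemma bij_betw_digit_rev: "bij_betw (digit_rev k) {..<p k} {..<p k}"
proof -
  have "inj_on (digit_rev k) {..<p k}"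
  proof (induction k)
    case (Suc k)
    define q where "q = p (Suc k) div p k"
    have q: "0 < q" "p (Suc k) = p k * q" using radix_pos p_Suc_eq by (simp_all add: q_def)
    show ?case
    proof (rule inj_onI)
      fix m m' assume m: "m \<in> {..<p (Suc k)}" "m' \<in> {..<p (Suc k)}"
        and eq: "digit_rev (Suc k) m = digit_rev (Suc k) m'"
      have rev: "digit_rev k (m div q) = digit_rev k (m' div q)"
        using digit_rev_mod[of k m] digit_rev_mod[of k m'] eq by (simp only: q_def)
      have "m div q \<in> {..<p k}" "m' div q \<in> {..<p k}"
        using m q by (simp_all add: less_mult_imp_div_less)
      then have "m div q = m' div q"
        using rev Suc.IH by (simp only: inj_on_eq_iff)
      moreover have "m mod q = m' mod q"
        using eq rev p_pos[of k] by (simp add: q_def[symmetric])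
      ultimately show "m = m'" by (metis div_mult_mod_eq)
    qed
  qed (simp add: p_0 inj_on_def)
  moreover from this have "digit_rev k ` {..<p k} = {..<p k}"
    using digit_rev_less by (intro endo_inj_surj) auto
  ultimately show ?thesis by (simp add: bij_betw_def)
qed

text \<open>
  For uniform \<open>u\<close> in the unit interval, the sequence of these residues is a Haar-distributed
  point of the odometer \<open>lim \<int>/p\<^sub>k\<int>\<close>.
\<close>

definition odo :: "nat \<Rightarrow> real \<Rightarrow> nat" where
  "odo k u = digit_rev k (nat \<lfloor>real (p k) * u\<rfloor>)"

lemma odo_mod: "odo (Suc k) u mod p k = odo k u"
proof -
  define q where "q = p (Suc k) div p k"
  have q: "0 < q" "p (Suc k) = p k * q" using radix_pos p_Suc_eq by (simp_all add: q_def)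
  have "\<lfloor>real (p k) * u\<rfloor> = \<lfloor>real (p (Suc k)) * u / real_of_int (int q)\<rfloor>"
    using q by simp
  also have "\<dots> = \<lfloor>real (p (Suc k)) * u\<rfloor> div int q"
    by (rule floor_divide_real_eq_div) simp
  finally have "nat \<lfloor>real (p k) * u\<rfloor> = nat \<lfloor>real (p (Suc k)) * u\<rfloor> div q"
    by (simp add: nat_div_distrib')
  then show ?thesis
    by (simp only: odo_def digit_rev_mod q_def[symmetric])
qed

definition unif :: "real measure" where
  "unif = uniform_measure lborel {0..<1}"

lemma prob_space_unif: "prob_space unif"
  unfolding unif_def by (rule prob_space_uniform_measure) auto

lemma space_unif [simp]: "space unif = UNIV"
  by (simp add: unif_def)

lemma sets_unif [simp, measurable_cong]: "sets unif = sets borel"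
  by (simp add: unif_def)

lemma odo_measurable [measurable]: "odo k \<in> measurable unif (count_space UNIV)"
  unfolding odo_def by measurable

text \<open>
  The integer part of \<open>p\<^sub>k u\<close> is uniform on \<open>{0, \<dots>, p\<^sub>k - 1}\<close>, and digit reversal permutes that
  set.
\<close>

lemma measure_unif_odo:
  "measure unif {u. odo k u \<in> B} = real (card {z. z < p k \<and> z \<in> B}) / real (p k)"
proof -
  interpret prob_space unif by (rule prob_space_unif)
  define P where "P = real (p k)"
  have P: "P > 0" using p_pos by (simp add: P_def)
  define J where "J m = {u. nat \<lfloor>P * u\<rfloor> = m}" for m
  have J_meas [measurable]: "J m \<in> sets borel" for m
  proof -
    have "{u \<in> space borel. nat \<lfloor>P * u\<rfloor> = m} \<in> sets borel" by measurable
    then show ?thesis by (simp add: J_def)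
  qed
  have prob_J: "prob (J m) = 1 / P" if m: "m < p k" for m
  proof -
    have "{0..<1} \<inter> J m = {real m / P..<(real m + 1) / P}"
    proof (intro equalityI subsetI)
      fix u assume u: "u \<in> {0..<1} \<inter> J m"
      then have "\<lfloor>P * u\<rfloor> = int m" using P by (auto simp: J_def)
      then show "u \<in> {real m / P..<(real m + 1) / P}"
        using P by (auto simp: floor_eq_iff field_simps)
    next
      fix u assume u: "u \<in> {real m / P..<(real m + 1) / P}"
      then have "real m \<le> P * u" "P * u < real m + 1"
        using P by (auto simp: field_simps)
      then have "\<lfloor>P * u\<rfloor> = int m" by (simp add: floor_eq_iff)
      moreover have "0 \<le> u"
        using u P by (auto intro: order.trans[rotated])
      moreover have "P * u < P * 1"
        using \<open>P * u < real m + 1\<close> m unfolding P_def by linarith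
      then have "u < 1" using P by (simp only: mult_less_cancel_left_pos)
      ultimately show "u \<in> {0..<1} \<inter> J m" by (simp add: J_def)
    qed
    then have "prob (J m) = measure lborel {real m / P..<(real m + 1) / P}"
      unfolding unif_def by (subst measure_uniform_measure) auto
    also have "\<dots> = 1 / P" using P by (simp add: field_simps)
    finally show ?thesis .
  qed
  define I where "I = {m. m < p k \<and> digit_rev k m \<in> B}"
  have "AE u in unif. u \<in> {0..<1}"
    unfolding unif_def by (rule AE_uniform_measureI) auto
  then have "AE u in unif. u \<in> {u. odo k u \<in> B} \<longleftrightarrow> u \<in> (\<Union>m\<in>I. J m)"
  proof eventually_elim
    case (elim u)
    then have "P * u < P" using P by simp
    then have "\<lfloor>P * u\<rfloor> < int (p k)"
      by (simp add: floor_less_iff P_def)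
    then have "nat \<lfloor>P * u\<rfloor> < p k"
      using p_pos[of k] by linarith
    then show ?case by (auto simp: I_def J_def odo_def P_def)
  qed
  then have "prob {u. odo k u \<in> B} = prob (\<Union>m\<in>I. J m)"
  proof (rule finite_measure_eq_AE)
    have "{u \<in> space unif. odo k u \<in> B} \<in> events" by measurable
    then show "{u. odo k u \<in> B} \<in> events" by simp
    show "(\<Union>m\<in>I. J m) \<in> events" by (auto intro!: sets.countable_UN)
  qed
  also have "\<dots> = (\<Sum>m\<in>I. prob (J m))"
    by (rule finite_measure_finite_Union) (auto simp: I_def disjoint_family_on_def J_def[abs_def] intro: J_meas[unfolded J_def])
  also have "\<dots> = real (card I) / P"
    by (simp add: prob_J I_def)
  also have "card I = card {z. z < p k \<and> z \<in> B}"
  proof (rule bij_betw_same_card)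
    show "bij_betw (digit_rev k) I {z. z < p k \<and> z \<in> B}"
      using bij_betw_digit_rev[of k] unfolding I_def bij_betw_def inj_on_def by auto
  qed
  finally show ?thesis by (simp add: P_def)
qed

end

section \<open>Invariant measures close to a point mass\<close>

context thin_oxtoby
begin

text \<open>
  The levels of the parity for which the first block has its holes filled with \<open>c\<close>.
\<close>

definition level :: "bool \<Rightarrow> nat \<Rightarrow> nat" where
  "level c j = 2 * j + (if c then 0 else 1)"

definition sample :: "bool \<Rightarrow> nat \<Rightarrow> real \<Rightarrow> nat \<Rightarrow> bool" where
  "sample c j u = (shift ^^ odo (Suc (level c j)) u) (oxtoby p)"

text \<open>
  The formula is the lower limit of the samples, so that it is defined and measurable
  everywhere; almost surely it is the limit.
\<close>

definition limit_sample :: "bool \<Rightarrow> real \<Rightarrow> nat \<Rightarrow> bool" where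
  "limit_sample c u i \<longleftrightarrow> (\<exists>m. \<forall>j\<ge>m. sample c j u i)"

lemma even_level: "even (level c j) = c"
  by (simp add: level_def)

text \<open>
  By \<open>oxtoby_lift_eq\<close> two consecutive samples differ at \<open>i\<close> only if \<open>i\<close> steps leave the first block
  at one of the two levels, or if the later position lies in the intermediate set \<open>M\<^sub>K\<^sub>+\<^sub>2\<close>.
\<close>

lemma measure_sample_neq_le:
  "measure unif {u. sample c (Suc j) u i \<noteq> sample c j u i} \<le> 2 * (real i * (1 / 3) ^ j) + 2 * gap (Suc (level c j))"
proof -
  interpret prob_space unif by (rule prob_space_unif)
  define K where "K = level c j"
  have K: "level c (Suc j) = Suc (Suc K)" by (simp add: K_def level_def)
  have Kj: "j \<le> K" by (simp add: K_def level_def)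
  have events: "{u. odo k u \<in> B} \<in> events" for k B
  proof -
    have "{u \<in> space unif. odo k u \<in> B} \<in> events" by measurable
    then show ?thesis by simp
  qed
  define V where "V k = {z. p k \<le> z + i}" for k
  have V: "prob {u. odo k u \<in> V k} \<le> real i * (1 / 3) ^ j" if "j \<le> k" for k
  proof -
    have "{z. z < p k \<and> z \<in> V k} \<subseteq> {p k - i..<p k}" by (auto simp: V_def)
    then have "card {z. z < p k \<and> z \<in> V k} \<le> card {p k - i..<p k}"
      by (intro card_mono) auto
    then have "prob {u. odo k u \<in> V k} \<le> real i / real (p k)"
      unfolding measure_unif_odo by (intro divide_right_mono) auto
    also have "3 ^ j \<le> p k"
      using power_le_p[of k] that by (meson order.trans power_increasing one_le_numeral)
    then have "real (3 ^ j) \<le> real (p k)" by (simp only: of_nat_le_iff)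
    then have "real i / real (p k) \<le> real i / 3 ^ j"
      by (intro divide_left_mono) (auto simp: p_pos)
    also have "real i / 3 ^ j = real i * (1 / 3) ^ j" by (simp add: power_one_over)
    finally show ?thesis .
  qed
  define R where "R = {z. z + i \<in> oxtoby_M p (Suc (Suc K))}"
  have "{z. z < p (Suc (Suc (Suc K))) \<and> z \<in> R} = {z. z < p (Suc (Suc (Suc K))) \<and> i + z \<in> oxtoby_M p (Suc (Suc K))}"
    by (simp add: R_def add.commute)
  then have R: "prob {u. odo (Suc (Suc (Suc K))) u \<in> R} = 2 * gap (Suc K)"
    unfolding measure_unif_odo
    using card_window_M[of "Suc (Suc K)" "p (Suc (Suc (Suc K)))" i] p_pos[of "Suc (Suc (Suc K))"]
    by (simp add: gap_def)
  \<comment> \<open>Compatibility over two levels, as the samples use every second level.\<close>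
  have mod: "odo (Suc (Suc (Suc K))) u mod p (Suc K) = odo (Suc K) u" for u
    using odo_mod[of "Suc (Suc K)" u] odo_mod[of "Suc K" u] mod_mod_cancel[OF p_dvd_Suc[of "Suc K"]] by metis
  have "{u. sample c (Suc j) u i \<noteq> sample c j u i} \<subseteq> {u. odo (Suc K) u \<in> V (Suc K)} \<union>
      {u. odo (Suc (Suc (Suc K))) u \<in> V (Suc (Suc (Suc K)))} \<union> {u. odo (Suc (Suc (Suc K))) u \<in> R}"
    using oxtoby_lift_eq[OF mod] by (auto simp: sample_def funpow_shift K K_def[symmetric] V_def R_def not_le[symmetric])
  then have "prob {u. sample c (Suc j) u i \<noteq> sample c j u i} \<le> prob ({u. odo (Suc K) u \<in> V (Suc K)} \<union>
      {u. odo (Suc (Suc (Suc K))) u \<in> V (Suc (Suc (Suc K)))} \<union> {u. odo (Suc (Suc (Suc K))) u \<in> R})"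
    by (intro finite_measure_mono sets.Un events)
  also have "\<dots> \<le> real i * (1 / 3) ^ j + real i * (1 / 3) ^ j + 2 * gap (Suc K)"
    using V[of "Suc K"] V[of "Suc (Suc (Suc K))"] Kj R
    by (intro order.trans[OF measure_Un_le] add_mono order.trans[OF measure_Un_le] sets.Un events) simp_all
  finally show ?thesis by (simp add: K_def)
qed

lemma level_ge: "j \<le> level c j"
  by (simp add: level_def)

lemma AE_sample_converges:
  "AE u in unif. \<forall>i. \<forall>\<^sub>F j in sequentially. sample c j u i = limit_sample c u i"
proof -
  interpret prob_space unif by (rule prob_space_unif)
  have "AE u in unif. \<forall>\<^sub>F j in sequentially. sample c j u i = limit_sample c u i" for i
  proof -
    define D where "D j = {u. sample c (Suc j) u i \<noteq> sample c j u i}" for j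
    have "AE u in unif. \<forall>\<^sub>F j in sequentially. u \<in> space unif - D j"
    proof (rule borel_cantelli_AE1)
      show "D j \<in> events" for j
      proof -
        have "{u \<in> space unif. sample c (Suc j) u i \<noteq> sample c j u i} \<in> events"
          unfolding sample_def by measurable
        then show ?thesis by (simp add: D_def)
      qed
      have "inj (\<lambda>j. Suc (level c j))" by (rule injI) (simp add: level_def)
      then have "summable (gap \<circ> (\<lambda>j. Suc (level c j)))"
        using summable_gap by (intro summable_reindex) (auto simp: gap_def)
      then have "summable (\<lambda>j. 2 * (real i * (1 / 3) ^ j) + 2 * gap (Suc (level c j)))"
        by (intro summable_add summable_mult summable_geometric) (simp_all add: comp_def)
      then show "summable (\<lambda>j. prob (D j))"
        by (rule summable_comparison_test_ev[rotated], intro always_eventually allI)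
          (simp only: real_norm_def abs_of_nonneg measure_nonneg D_def measure_sample_neq_le)
    qed (simp add: less_top[symmetric])
    then show ?thesis
    proof eventually_elim
      case (elim u)
      then obtain m where m: "\<And>j. j \<ge> m \<Longrightarrow> sample c (Suc j) u i = sample c j u i"
        unfolding eventually_sequentially D_def by auto
      define b where "b = sample c m u i"
      have b: "sample c j u i = b" if "j \<ge> m" for j
        using that
      proof (induction rule: dec_induct)
        case (step j)
        then show ?case using m[of j] by simp
      qed (simp add: b_def)
      have "limit_sample c u i = b"
      proof (cases b)
        case True
        then show ?thesis using b unfolding limit_sample_def by auto
      next
        case False
        have "\<not> sample c (max m n) u i" for n
          using b[of "max m n"] False by simp
        then show ?thesis using False unfolding limit_sample_def
          by (auto simp: not_le) (meson max.cobounded2)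
      qed
      then show ?case
        using b unfolding eventually_sequentially by (intro exI[of _ m]) simp
    qed
  qed
  then show ?thesis by (simp add: AE_all_countable)
qed

lemma AE_sample_converges_window:
  "AE u in unif. \<forall>W. \<forall>\<^sub>F j in sequentially. \<forall>i<W. sample c j u i = limit_sample c u i"
  using AE_sample_converges[of c]
proof eventually_elim
  case (elim u)
  show ?case
  proof
    fix W
    have "\<forall>\<^sub>F j in sequentially. \<forall>i\<in>{..<W}. sample c j u i = limit_sample c u i"
      using elim by (intro eventually_ball_finite) auto
    then show "\<forall>\<^sub>F j in sequentially. \<forall>i<W. sample c j u i = limit_sample c u i"
      by (simp only: Ball_def lessThan_iff)
  qed
qed

lemma limit_sample_measurable [measurable]: "limit_sample c \<in> borel_measurable unif"
proof -
  have "(\<lambda>u. limit_sample c u i) \<in> borel_measurable unif" for i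
  proof (rule pred_borel_measurable)
    show "Measurable.pred unif (\<lambda>u. limit_sample c u i)"
      unfolding limit_sample_def sample_def by measurable
  qed
  then have "limit_sample c \<in> measurable unif (PiM UNIV (\<lambda>_. borel))"
    by (intro measurable_PiM_single') (auto simp: space_PiM)
  then show ?thesis
    by (simp add: sets_PiM_equal_borel cong: measurable_cong_sets)
qed

text \<open>
  The law of the limit is the weak limit of the empirical measures of \<open>x\<close> along the chosen
  levels.
\<close>

lemma frequency_tendsto:
  assumes C: "finitary C"
  shows "(\<lambda>j. real (card {z. z < p (Suc (level c j)) \<and> (shift ^^ z) (oxtoby p) \<in> C}) / real (p (Suc (level c j))))
    \<longlonglongrightarrow> measure (distr unif borel (limit_sample c)) C"
proof -
  interpret prob_space unif by (rule prob_space_unif)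
  obtain W where W: "depends_on W C"
    using C unfolding finitary_def by (elim exE)
  have [measurable]: "C \<in> sets borel" using C by (rule finitary_borel)
  have "(\<lambda>j. prob {u. sample c j u \<in> C}) \<longlonglongrightarrow> prob {u. limit_sample c u \<in> C}"
  proof (rule tendsto_prob_of_AE_eventually)
    have "{u \<in> space unif. sample c j u \<in> C} \<in> events" for j
      unfolding sample_def by measurable
    then show "{u. sample c j u \<in> C} \<in> events" for j by simp
    have "{u \<in> space unif. limit_sample c u \<in> C} \<in> events" by measurable
    then show "{u. limit_sample c u \<in> C} \<in> events" by simp
    show "AE u in unif. \<forall>\<^sub>F j in sequentially. (u \<in> {u. sample c j u \<in> C}) = (u \<in> {u. limit_sample c u \<in> C})"
      using AE_sample_converges_window[of c]
    proof eventually_elim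
      case (elim u)
      from elim[THEN spec, of W] show ?case
      proof eventually_elim
        case (elim j)
        then show ?case using depends_onD[OF W, of "sample c j u" "limit_sample c u"] by simp
      qed
    qed
  qed
  moreover have "prob {u. limit_sample c u \<in> C} = measure (distr unif borel (limit_sample c)) C"
    by (subst measure_distr) (simp_all add: vimage_def)
  moreover have "prob {u. sample c j u \<in> C} =
      real (card {z. z < p (Suc (level c j)) \<and> (shift ^^ z) (oxtoby p) \<in> C}) / real (p (Suc (level c j)))" for j
    using measure_unif_odo[of "Suc (level c j)" "{z. (shift ^^ z) (oxtoby p) \<in> C}"]
    by (simp add: sample_def)
  ultimately show ?thesis by simp
qed

lemma inverse_p_level_tendsto: "(\<lambda>j. 1 / real (p (Suc (level c j)))) \<longlonglongrightarrow> 0"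
proof (rule tendsto_sandwich[OF _ _ tendsto_const LIMSEQ_inverse_real_of_nat])
  have "1 / real (p (Suc (level c j))) \<le> inverse (real (Suc j))" for j
  proof -
    have "Suc j \<le> p (Suc (level c j))"
      using less_p[of "Suc (level c j)"] level_ge[of j c] by simp
    then have "real (Suc j) \<le> real (p (Suc (level c j)))" by (simp only: of_nat_le_iff)
    then show ?thesis unfolding inverse_eq_divide by (intro divide_left_mono) (simp_all add: p_pos)
  qed
  then show "\<forall>\<^sub>F j in sequentially. 1 / real (p (Suc (level c j))) \<le> inverse (real (Suc j))" by simp
qed simp

text \<open>
  The law of the limit is invariant as a limit of empirical measures, lives on the closed set
  of limits of shifts of \<open>x\<close>, and gives the wrong symbol a probability bounded by the frequency
  of positions that are not holes, hence by \<open>S\<close>.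
\<close>

lemma ex_measure_near_constant:
  "\<exists>\<mu>\<in>invariant_measures X. measure \<mu> {y. y 0 \<noteq> c} \<le> S"
proof
  interpret prob_space unif by (rule prob_space_unif)
  define \<mu> where "\<mu> = distr unif borel (limit_sample c)"
  define N where "N j = p (Suc (level c j))" for j
  interpret \<mu>: prob_space \<mu> unfolding \<mu>_def by (rule prob_space_distr) measurable
  have sets: "sets \<mu> = sets borel" by (simp add: \<mu>_def)
  then have meas: "shift \<in> \<mu> \<rightarrow>\<^sub>M borel" by (simp cong: measurable_cong_sets)
  note freq = frequency_tendsto[of _ c, folded N_def \<mu>_def]
  have "distr \<mu> borel shift = \<mu>"
  proof (rule finite_borel_measure_eqI)
    fix C assume C: "finitary C"
    interpret D: prob_space "distr \<mu> borel shift" by (rule \<mu>.prob_space_distr[OF meas])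
    define a where "a j = real (card {z. z < N j \<and> (shift ^^ z) (oxtoby p) \<in> C}) / real (N j)" for j
    define b where "b j = real (card {z. z < N j \<and> (shift ^^ Suc z) (oxtoby p) \<in> C}) / real (N j)" for j
    have a: "a \<longlonglongrightarrow> \<mu>.prob C"
      using freq[OF C] by (simp add: a_def[abs_def])
    have b: "b \<longlonglongrightarrow> \<mu>.prob {y. shift y \<in> C}"
      using freq[OF finitary_shift[OF C]] by (simp add: b_def[abs_def])
    \<comment> \<open>The windows \<open>[0, N)\<close> and \<open>[1, N]\<close> have almost the same counts.\<close>
    have "(\<lambda>j. b j - a j) \<longlonglongrightarrow> 0"
    proof (rule Lim_null_comparison[OF always_eventually inverse_p_level_tendsto[of c, folded N_def]], intro allI)
      fix j
      have "\<bar>b j - a j\<bar> = \<bar>real (card {z. z < N j \<and> (shift ^^ Suc z) (oxtoby p) \<in> C}) -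
          real (card {z. z < N j \<and> (shift ^^ z) (oxtoby p) \<in> C})\<bar> / real (N j)"
        by (simp add: a_def b_def diff_divide_distrib[symmetric] abs_divide)
      also have "\<dots> \<le> 1 / real (N j)"
        by (intro divide_right_mono card_Suc_window_diff) simp
      finally show "norm (b j - a j) \<le> 1 / real (N j)" by simp
    qed
    moreover have "(\<lambda>j. b j - a j) \<longlonglongrightarrow> \<mu>.prob {y. shift y \<in> C} - \<mu>.prob C"
      by (intro tendsto_diff a b)
    ultimately have "\<mu>.prob {y. shift y \<in> C} = \<mu>.prob C"
      using LIMSEQ_unique by fastforce
    moreover have "measure (distr \<mu> borel shift) C = \<mu>.prob {y. shift y \<in> C}"
      using finitary_borel[OF C] sets_eq_imp_space_eq[OF sets]
      by (subst measure_distr[OF meas]) (simp_all add: vimage_def)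
    ultimately show "emeasure (distr \<mu> borel shift) C = emeasure \<mu> C"
      by (simp add: \<mu>.emeasure_eq_measure D.emeasure_eq_measure)
  next
    interpret D: prob_space "distr \<mu> borel shift" by (rule \<mu>.prob_space_distr[OF meas])
    show "finite_measure (distr \<mu> borel shift)" by unfold_locales
  qed (simp_all add: sets)
  moreover have "emeasure \<mu> X = 1"
  proof -
    have "AE u in unif. limit_sample c u \<in> X"
      using AE_sample_converges_window[of c]
    proof eventually_elim
      case (elim u)
      show ?case
        unfolding mem_orbit_closure_iff
      proof
        fix W
        obtain j where "\<forall>i<W. sample c j u i = limit_sample c u i"
          using elim[THEN spec, of W] unfolding eventually_sequentially by auto
        then have "\<forall>i<W. limit_sample c u i = oxtoby p (odo (Suc (level c j)) u + i)"
          by (simp add: sample_def funpow_shift)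
        then show "\<exists>n. \<forall>i<W. limit_sample c u i = oxtoby p (n + i)" ..
      qed
    qed
    moreover have "X \<in> sets borel" by (simp add: orbit_closure_def)
    ultimately have "AE y in \<mu>. y \<in> X"
      unfolding \<mu>_def by (subst AE_distr_iff) auto
    then show ?thesis
      by (intro \<mu>.emeasure_eq_1_AE) (simp_all add: sets orbit_closure_def)
  qed
  ultimately show "\<mu> \<in> invariant_measures X"
    by (simp add: invariant_measures_def sets \<mu>.prob_space_axioms)
  have "finitary {y. y 0 \<noteq> c}"
    using finitary_binop[OF finitary_coord finitary_coord, where op = "\<lambda>a _. a \<noteq> c"] .
  then show "measure \<mu> {y. y 0 \<noteq> c} \<le> S"
  proof (rule LIMSEQ_le_const2[OF freq], intro exI[of _ 0] allI impI)
    fix j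
    have "oxtoby p z = c" if "z < N j" "hole (level c j) z" for z
      using oxtoby_below_p[of z "level c j"] that by (simp add: N_def even_level)
    then have "card {z. z < N j \<and> (shift ^^ z) (oxtoby p) \<in> {y. y 0 \<noteq> c}} \<le>
        card {z. z < N j \<and> \<not> hole (level c j) (0 + z)}"
      by (intro card_mono) (auto simp: funpow_shift)
    also have "real \<dots> \<le> real (N j) * S"
      unfolding N_def by (rule card_window_not_hole_le) simp
    finally have "real (card {z. z < N j \<and> (shift ^^ z) (oxtoby p) \<in> {y. y 0 \<noteq> c}}) \<le> real (N j) * S"
      by simp
    then show "real (card {z. z < N j \<and> (shift ^^ z) (oxtoby p) \<in> {y. y 0 \<noteq> c}}) / real (N j) \<le> S"
      using p_pos[of "Suc (level c j)"] by (simp add: N_def field_simps)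
  qed
qed

end

section \<open>The two Hausdorff distances\<close>

text \<open>
  Draw a constant sequence from \<open>\<nu>\<close> and, independently, points from the two measures
  concentrated near \<open>0\<close> and near \<open>1\<close>; then select the point belonging to the constant drawn. The
  selection commutes with the shift since constant sequences are fixed points, so the selected
  point and the constant sequence form a joining.
\<close>

lemma (in thin_oxtoby) ex_oxtoby_measure_near:
  assumes \<nu>: "\<nu> \<in> invariant_measures {\<lambda>_. False, \<lambda>_. True}"
  shows "\<exists>\<mu>\<in>invariant_measures X. dbar_measure \<mu> \<nu> \<le> ereal S"
proof -
  obtain \<mu>0 where \<mu>0: "\<mu>0 \<in> invariant_measures X" "measure \<mu>0 {y. y 0 \<noteq> False} \<le> S"
    using ex_measure_near_constant by blast
  obtain \<mu>1 where \<mu>1: "\<mu>1 \<in> invariant_measures X" "measure \<mu>1 {y. y 0 \<noteq> True} \<le> S"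
    using ex_measure_near_constant by blast
  have inv: "sets \<mu> = sets borel \<and> prob_space \<mu> \<and> shift \<in> \<mu> \<rightarrow>\<^sub>M \<mu> \<and> distr \<mu> \<mu> shift = \<mu>
      \<and> (AE y in \<mu>. y \<in> Y)" if "\<mu> \<in> invariant_measures Y" "closed Y" for \<mu> Y
  proof -
    have sets: "sets \<mu> = sets borel" and "prob_space \<mu>" and d: "distr \<mu> borel shift = \<mu>" and 1: "emeasure \<mu> Y = 1"
      using that(1) by (auto simp: invariant_measures_def)
    interpret prob_space \<mu> by fact
    have "AE y in \<mu>. y \<in> Y"
      using 1 that(2) by (subst AE_in_set_eq_1) (simp_all add: sets emeasure_eq_measure)
    moreover have "distr \<mu> \<mu> shift = \<mu>" using d by (metis distr_cong sets)
    moreover have "shift \<in> \<mu> \<rightarrow>\<^sub>M \<mu>"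
      using shift_measurable by (simp add: sets cong: measurable_cong_sets)
    ultimately show ?thesis using sets \<open>prob_space \<mu>\<close> by blast
  qed
  have "closed X" by (simp add: orbit_closure_def)
  note inv0 = inv[OF \<mu>0(1) this] and inv1 = inv[OF \<mu>1(1) this] and inv\<nu> = inv[OF \<nu> closed_constants]
  have [measurable_cong]: "sets \<nu> = sets borel" "sets \<mu>0 = sets borel" "sets \<mu>1 = sets borel"
    using inv0 inv1 inv\<nu> by blast+
  have spaces: "space \<nu> = UNIV" "space \<mu>0 = UNIV" "space \<mu>1 = UNIV"
    using inv0 inv1 inv\<nu> by (auto dest: sets_eq_imp_space_eq)
  interpret \<nu>: prob_space \<nu> using inv\<nu> by blast
  interpret \<mu>0: prob_space \<mu>0 using inv0 by blast
  interpret \<mu>1: prob_space \<mu>1 using inv1 by blast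
  interpret P01: pair_prob_space \<mu>0 \<mu>1 ..
  interpret P: pair_prob_space \<nu> "\<mu>0 \<Otimes>\<^sub>M \<mu>1" ..
  define \<Omega> where "\<Omega> = \<nu> \<Otimes>\<^sub>M (\<mu>0 \<Otimes>\<^sub>M \<mu>1)"
  define T where "T = map_prod shift (map_prod shift shift)"
  define f where "f w = (if fst w 0 then snd (snd w) else fst (snd w))"
    for w :: "(nat \<Rightarrow> bool) \<times> (nat \<Rightarrow> bool) \<times> (nat \<Rightarrow> bool)"
  have \<Omega>: "prob_space \<Omega>" unfolding \<Omega>_def by (rule P.prob_space_axioms)
  interpret \<Omega>: prob_space \<Omega> by (rule \<Omega>)
  have [measurable_cong]: "sets \<Omega> = sets (\<nu> \<Otimes>\<^sub>M (\<mu>0 \<Otimes>\<^sub>M \<mu>1))" by (simp add: \<Omega>_def)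
  have T_meas: "T \<in> \<Omega> \<rightarrow>\<^sub>M \<Omega>" unfolding T_def map_prod_def by measurable
  have T_inv: "distr \<Omega> \<Omega> T = \<Omega>"
    unfolding \<Omega>_def T_def
    using inv0 inv1 inv\<nu> by (intro distr_pair_invariant P01.prob_space_axioms) (auto simp: map_prod_def)
  have coord: "Measurable.pred borel (\<lambda>y :: nat \<Rightarrow> bool. y 0)"
    using finitary_borel[OF finitary_coord] by (simp add: pred_def)
  note [measurable] = coord
  have f_meas: "f \<in> borel_measurable \<Omega>" unfolding f_def by measurable
  have fst_meas: "fst \<in> borel_measurable \<Omega>" by measurable
  have fst_distr: "distr \<Omega> borel fst = \<nu>"
  proof -
    have "distr \<Omega> borel fst = distr \<Omega> \<nu> fst" using inv\<nu> by (intro distr_cong) auto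
    then show ?thesis unfolding \<Omega>_def using P01.distr_pair_fst by simp
  qed
  have ae_fst: "AE w in \<Omega>. fst w \<in> {\<lambda>_. False, \<lambda>_. True}"
    using inv\<nu> by (intro AE_distrD[OF fst_meas]) (simp only: fst_distr)
  then have f_shift: "AE w in \<Omega>. f (T w) = shift (f w)"
    by eventually_elim (auto simp: f_def T_def shift_def)
  have ae_X: "AE w in \<Omega>. f w \<in> X"
  proof -
    have snd: "distr \<Omega> (\<mu>0 \<Otimes>\<^sub>M \<mu>1) snd = \<mu>0 \<Otimes>\<^sub>M \<mu>1"
      unfolding \<Omega>_def using inv\<nu> P01.prob_space_axioms by (intro distr_pair_snd) auto
    have fst0: "distr (\<mu>0 \<Otimes>\<^sub>M \<mu>1) \<mu>0 fst = \<mu>0" by (rule \<mu>1.distr_pair_fst)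
    have snd1: "distr (\<mu>0 \<Otimes>\<^sub>M \<mu>1) \<mu>1 snd = \<mu>1"
      using inv0 inv1 by (intro distr_pair_snd) auto
    have "AE v in \<mu>0 \<Otimes>\<^sub>M \<mu>1. fst v \<in> X"
      by (rule AE_distrD[OF measurable_fst]) (use inv0 in \<open>simp only: fst0\<close>)
    moreover have "AE v in \<mu>0 \<Otimes>\<^sub>M \<mu>1. snd v \<in> X"
      by (rule AE_distrD[OF measurable_snd]) (use inv1 in \<open>simp only: snd1\<close>)
    ultimately have "AE v in \<mu>0 \<Otimes>\<^sub>M \<mu>1. fst v \<in> X \<and> snd v \<in> X" by eventually_elim simp
    then have "AE w in \<Omega>. fst (snd w) \<in> X \<and> snd (snd w) \<in> X"
      by (intro AE_distrD[of snd \<Omega> "\<mu>0 \<Otimes>\<^sub>M \<mu>1" "\<lambda>v. fst v \<in> X \<and> snd v \<in> X"])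
        (measurable, simp only: snd)
    then show ?thesis by eventually_elim (simp add: f_def)
  qed
  have "distr \<Omega> borel f \<in> invariant_measures X"
    using \<open>closed X\<close> ae_X by (intro distr_mem_invariant_measures[OF \<Omega> T_meas f_meas T_inv f_shift])
  moreover have "dbar_measure (distr \<Omega> borel f) \<nu> \<le> ereal S"
  proof -
    have "AE w in \<Omega>. fst (T w) = shift (fst w)" by (simp add: T_def)
    from dbar_measure_distr_le[OF \<Omega> T_meas f_meas fst_meas T_inv f_shift this]
    have "dbar_measure (distr \<Omega> borel f) \<nu> \<le> ereal (\<Omega>.prob {w \<in> space \<Omega>. f w 0 \<noteq> fst w 0})"
      by (simp only: fst_distr)
    also have "\<Omega>.prob {w \<in> space \<Omega>. f w 0 \<noteq> fst w 0} \<le> S"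
    proof -
      define A where "A b = {y :: nat \<Rightarrow> bool. y 0 = b}" for b
      have A: "A b \<in> sets borel" for b
      proof -
        have "{y \<in> space borel. (y :: nat \<Rightarrow> bool) 0 = b} \<in> sets borel" by measurable
        then show ?thesis by (simp add: A_def)
      qed
      then have A': "A b \<in> sets \<nu>" "A b \<in> sets \<mu>0" "A b \<in> sets \<mu>1" for b
        using inv0 inv1 inv\<nu> by simp_all
      have U: "UNIV \<in> sets \<mu>0" "UNIV \<in> sets \<mu>1"
        using inv0 inv1 by simp_all
      have B: "A True \<times> UNIV \<in> sets (\<mu>0 \<Otimes>\<^sub>M \<mu>1)" "UNIV \<times> A False \<in> sets (\<mu>0 \<Otimes>\<^sub>M \<mu>1)"
        by (intro pair_measureI A' U)+
      have "{w \<in> space \<Omega>. f w 0 \<noteq> fst w 0} = A False \<times> (A True \<times> UNIV) \<union> A True \<times> (UNIV \<times> A False)"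
        by (auto simp: A_def f_def \<Omega>_def space_pair_measure spaces split: if_splits)
      also have "\<Omega>.prob \<dots> \<le> \<Omega>.prob (A False \<times> (A True \<times> UNIV)) + \<Omega>.prob (A True \<times> (UNIV \<times> A False))"
        unfolding \<Omega>_def by (intro measure_Un_le pair_measureI[OF A'(1) B(1)] pair_measureI[OF A'(1) B(2)])
      also have "\<Omega>.prob (A False \<times> (A True \<times> UNIV)) = measure \<nu> (A False) * measure \<mu>0 (A True)"
        unfolding \<Omega>_def using A' B U \<mu>1.prob_space
        by (simp add: measure_pair_Times P01.prob_space_axioms \<mu>1.prob_space_axioms spaces)
      also have "\<Omega>.prob (A True \<times> (UNIV \<times> A False)) = measure \<nu> (A True) * measure \<mu>1 (A False)"
        unfolding \<Omega>_def using A' B U \<mu>0.prob_space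
        by (simp add: measure_pair_Times P01.prob_space_axioms \<mu>1.prob_space_axioms spaces)
      also have "measure \<nu> (A False) * measure \<mu>0 (A True) + measure \<nu> (A True) * measure \<mu>1 (A False)
          \<le> measure \<nu> (A False) * S + measure \<nu> (A True) * S"
        using \<mu>0(2) \<mu>1(2) by (intro add_mono mult_left_mono) (simp_all add: A_def)
      also have "\<dots> = (measure \<nu> (A False) + measure \<nu> (A True)) * S" by (simp add: algebra_simps)
      also have "measure \<nu> (A False) + measure \<nu> (A True) = measure \<nu> (A False \<union> A True)"
        using A' by (intro \<nu>.finite_measure_Union[symmetric]) (auto simp: A_def)
      also have "A False \<union> A True = space \<nu>" by (auto simp: A_def spaces)
      finally show ?thesis by (simp add: \<nu>.prob_space)
    qed
    finally show ?thesis by simp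
  qed
  ultimately show ?thesis by blast
qed

theorem proposition15:
  fixes \<delta> :: real and p :: "nat \<Rightarrow> nat"
  assumes "0 < \<delta>" and "\<delta> < 1 / 2"
    and "\<And>k. p k > 0" and "p 0 = 1"
    and "\<And>k. p k dvd p (Suc k)"
    and "\<And>k. real (p (Suc k)) / real (p k) \<ge> 3"
    and "summable (\<lambda>k. 2 * real (p (Suc k)) / real (p (Suc (Suc k))))"
    and "(\<Sum>k. 2 * real (p (Suc k)) / real (p (Suc (Suc k)))) < \<delta>"
  shows "minimal_shift_space (orbit_closure (oxtoby p)) \<and>
    hausdorff dbar (orbit_closure (oxtoby p)) {\<lambda>_. False, \<lambda>_. True} > ereal (1 - \<delta>) \<and>
    hausdorff dbar_measure (invariant_measures (orbit_closure (oxtoby p)))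
      (invariant_measures {\<lambda>_. False, \<lambda>_. True}) < ereal \<delta>"
proof -
  define S where "S = (\<Sum>k. 2 * real (p (Suc k)) / real (p (Suc (Suc k))))"
  have S: "S < \<delta>" using assms(8) by (simp add: S_def)
  have ratio: "3 * p k \<le> p (Suc k)" for k
  proof -
    have "3 * real (p k) \<le> real (p (Suc k))"
      using assms(3,6)[of k] by (simp add: field_simps)
    then show ?thesis by linarith
  qed
  interpret thin_oxtoby p S
    using assms S by unfold_locales (auto simp: ratio S_def summable_sums)
  have "oxtoby p \<in> X"
    unfolding mem_orbit_closure_iff by (intro allI exI[of _ 0]) simp
  have "ereal (1 - \<delta>) < ereal (1 - S)" using S by simp
  also have "\<dots> \<le> (INF b\<in>{\<lambda>_. False, \<lambda>_. True}. dbar (oxtoby p) b)"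
    using dbar_oxtoby_const_ge by (intro INF_greatest) auto
  also have "\<dots> \<le> hausdorff dbar X {\<lambda>_. False, \<lambda>_. True}"
    unfolding hausdorff_def by (intro max.coboundedI1 SUP_upper \<open>oxtoby p \<in> X\<close>)
  finally have far: "ereal (1 - \<delta>) < hausdorff dbar X {\<lambda>_. False, \<lambda>_. True}" .
  have "hausdorff dbar_measure (invariant_measures X) (invariant_measures {\<lambda>_. False, \<lambda>_. True}) \<le> ereal S"
    unfolding hausdorff_def
  proof (intro max.boundedI SUP_least)
    fix \<mu> assume "\<mu> \<in> invariant_measures X"
    then show "(INF \<nu>\<in>invariant_measures {\<lambda>_. False, \<lambda>_. True}. dbar_measure \<mu> \<nu>) \<le> ereal S"
      using ex_constant_measure_near INF_lower2 by meson
  next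
    fix \<nu> :: "(nat \<Rightarrow> bool) measure" assume "\<nu> \<in> invariant_measures {\<lambda>_. False, \<lambda>_. True}"
    then show "(INF \<mu>\<in>invariant_measures X. dbar_measure \<mu> \<nu>) \<le> ereal S"
      using ex_oxtoby_measure_near INF_lower2 by meson
  qed
  also have "\<dots> < ereal \<delta>" using S by simp
  finally show ?thesis using minimal_shift_space_X far by blast
qed

end
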